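(* Let $\mathcal H$ be a real Hilbert space, let $A\colon\mathcal H\to 2^{\mathcal H}$ be maximally monotone, let $\beta\in\left]0,+\infty\right[$, let $B\colon\mathcal H\to\mathcal H$ be $\beta$-cocoercive, assume that $\operatorname{zer}(A+B)\neq\varnothing$, and let $\overline w\in\operatorname{zer}(A+B)$. Suppose that $A$ is $\nu$-strongly monotone and $B$ is $\mu$-strongly monotone at $\overline w$, for some $(\nu,\mu)\in[0,+\infty[^2$ such that $\nu+\mu>0$. Let $(\underline\lambda,\overline\alpha)\in\left]0,+\infty\right[^2$, let $\theta\in\left]0,1\right]$, let $c_1\in\left]0,+\infty\right[$, let $\gamma_n=c_1n^{-\theta}$ for every $n\in\mathbb N^*$, and let $(\lambda_n)_{n\in\mathbb N^*}$ be a sequence in $[0,1]$ with $\inf_{n\in\mathbb N^*}\lambda_n\ge\underline\lambda$. Let $(\mathfrak B_n)_{n\in\mathbb N^*}$ be an $\mathcal H$-valued random process with $\mathbb E[\|\mathfrak B_n\|^2]<+\infty$ for every $n\in\mathbb N^*$, let $w_1$ be an $\mathcal H$-valued random variable with $\mathbb E[\|w_1\|^2]<+\infty$, and for every $n\in\mathbb N^*$ set $$z_n=w_n-\gamma_n\mathfrak B_n,\qquad y_n=J_{\gamma_nA}z_n,\qquad w_{n+1}=(1-\lambda_n)w_n+\lambda_ny_n .$$ Let $\mathcal F_n=\sigma(w_1,\ldots,w_n)$. Suppose that there exist $(\alpha_n)_{n\in\mathbb N^*}$ in $\left]0,+\infty\right[$ with $\sup_{n\in\mathbb N^*}\alpha_n\le\overline\alpha$,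 $\sigma\in\left]0,+\infty\right[$ and $\varepsilon\in\left]0,+\infty\right[$ such that, for every $n\in\mathbb N^*$, $$\mathbb E[\mathfrak B_n\mid\mathcal F_n]=Bw_n,\qquad \mathbb E[\|\mathfrak B_n-Bw_n\|^2\mid\mathcal F_n]\le\sigma^2(1+\alpha_n\|Bw_n\|^2),\qquad \gamma_n\le\frac{(2-\varepsilon)\beta}{1+2\sigma^2\alpha_n}.$$ Set $$t=1-2^{\theta-1}\ge0,\qquad c=\frac{c_1\underline\lambda(2\nu+\mu\varepsilon)}{(1+\nu)^2},\qquad \tau=\frac{2\sigma^2c_1^2(1+\overline\alpha\|B\overline w\|^2)}{c^2}.$$ Let $n_0>1$ be the smallest integer greater than $1$ such that $\max\{c,c_1\}n^{-\theta}\le1$ for every integer $n\ge n_0$, and let $s_n=\mathbb E[\|w_n-\overline w\|^2]$ for every $n\in\mathbb N^*$. Then the following hold: (i) If $\theta\in\left]0,1\right[$, then for every $n\ge2n_0$, $$s_{n+1}\le\Big(\tau c^2\varphi_{1-2\theta}(n)+s_{n_0}\exp\Big(\frac{cn_0^{1-\theta}}{1-\theta}\Big)\Big)\exp\Big(\frac{-ct(n+1)^{1-\theta}}{1-\theta}\Big)+\frac{\tau2^\theta c}{(n-2)^\theta}.$$ (ii) If $\theta=1$, then for every $n\ge2n_0$, $$s_{n+1}\le s_{n_0}\Big(\frac{n_0}{n+1}\Big)^c+\frac{\tau c^2}{(n+1)^c}\Big(1+\frac1{n_0}\Big)^c\varphi_{c-1}(n).$$ (iii) $s_n=O(n^{-\theta})$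 if $\theta\in\left]0,1\right[$; $s_n=O(n^{-c})$ if $\theta=1$ and $c<1$; $s_n=O(n^{-1}\log n)$ if $\theta=1$ and $c=1$; $s_n=O(n^{-1})$ if $\theta=1$ and $c>1$.
   Context: All random variables are defined on a fixed probability space; $\mathbb N^*=\mathbb N\setminus\{0\}$; $\mathcal H$ carries its Borel $\sigma$-algebra; $\langle\cdot\mid\cdot\rangle$ and $\|\cdot\|$ are the scalar product and norm of $\mathcal H$; $\sigma(w_1,\dots,w_n)$ is the $\sigma$-algebra generated by $w_1,\dots,w_n$. A random process is a sequence of integrable $\mathcal H$-valued random variables. A set-valued operator $A\colon\mathcal H\to2^{\mathcal H}$ is monotone if $\langle w-y\mid u-v\rangle\ge0$ for all $(w,u),(y,v)$ in its graph $\{(w,u): u\in Aw\}$, and maximally monotone if no monotone operator has a graph properly containing that of $A$. $A$ is $\nu$-strongly monotone if $A-\nu I$ is monotone (for $\nu=0$ this is just monotonicity). $B$ is $\mu$-strongly monotone at $y$ if $\langle w-y\mid Bw-By\rangle\ge\mu\|w-y\|^2$ for all $w\in\mathcal H$. $\operatorname{zer}(A+B)=\{w\in\mathcal H: 0\in Aw+Bw\}$. $J_{\gamma A}=(I+\gamma A)^{-1}$ is the resolvent, a single-valued map $\mathcal H\to\mathcal H$. $B\colon\mathcal H\to\mathcal H$ is $\beta$-cocoercive if $\langle w-y\mid Bw-By\rangle\ge\beta\|Bw-By\|^2$ for all $w,y\in\mathcal H$. For $c\in\mathbb R$, $\varphi_c\colon\left]0,+\infty\right[\to\mathbb R$ is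 defined by $\varphi_c(t)=(t^c-1)/c$ if $c\ne0$ and $\varphi_0(t)=\log t$. *)

theory Defs
  imports "HOL-Probability.Probability" "HOL-Library.Landau_Symbols"
begin

text \<open>
  A real Hilbert space is a type of sort \<open>{real_inner, complete_space}\<close>. A set-valued operator
  on \<open>'h\<close> is a function \<open>'h \<Rightarrow> 'h set\<close>.
\<close>

definition graph_of :: "('h \<Rightarrow> 'h set) \<Rightarrow> ('h \<times> 'h) set" where
  "graph_of A = {(w, u). u \<in> A w}"

definition monotone_op :: "('h::real_inner \<Rightarrow> 'h set) \<Rightarrow> bool" where
  "monotone_op A \<longleftrightarrow>
     (\<forall>(w, u) \<in> graph_of A. \<forall>(y, v) \<in> graph_of A. 0 \<le> inner (w - y) (u - v))"

definition maximally_monotone_op :: "('h::real_inner \<Rightarrow> 'h set) \<Rightarrow> bool" where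
  "maximally_monotone_op A \<longleftrightarrow>
     monotone_op A \<and> \<not> (\<exists>A'. monotone_op A' \<and> graph_of A \<subset> graph_of A')"

definition strongly_monotone_op :: "real \<Rightarrow> ('h::real_inner \<Rightarrow> 'h set) \<Rightarrow> bool" where
  "strongly_monotone_op \<nu> A \<longleftrightarrow> monotone_op (\<lambda>w. (\<lambda>u. u - \<nu> *\<^sub>R w) ` A w)"

definition strongly_monotone_at :: "real \<Rightarrow> ('h::real_inner \<Rightarrow> 'h) \<Rightarrow> 'h \<Rightarrow> bool" where
  "strongly_monotone_at \<mu> B y \<longleftrightarrow> (\<forall>w. inner (w - y) (B w - B y) \<ge> \<mu> * (norm (w - y))\<^sup>2)"

definition cocoercive :: "real \<Rightarrow> ('h::real_inner \<Rightarrow> 'h) \<Rightarrow> bool" where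
  "cocoercive \<beta> B \<longleftrightarrow> (\<forall>w y. inner (w - y) (B w - B y) \<ge> \<beta> * (norm (B w - B y))\<^sup>2)"

definition zer_sum :: "('h::real_inner \<Rightarrow> 'h set) \<Rightarrow> ('h \<Rightarrow> 'h) \<Rightarrow> 'h set" where
  "zer_sum A B = {w. 0 \<in> (\<lambda>u. u + B w) ` A w}"

text \<open>
  The resolvent \<open>J\<^bsub>\<gamma>A\<^esub> = (I + \<gamma>A)\<^sup>-\<^sup>1\<close> as the inverse of a set-valued
  operator. For \<open>\<gamma> > 0\<close> and \<open>A\<close> maximally monotone each \<open>resolvent \<gamma> A z\<close> is a singleton
  (Minty), so that \<open>y \<in> resolvent \<gamma> A z\<close> expresses \<open>y = J\<^bsub>\<gamma>A\<^esub> z\<close>.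
\<close>

definition resolvent :: "real \<Rightarrow> ('h::real_inner \<Rightarrow> 'h set) \<Rightarrow> 'h \<Rightarrow> 'h set" where
  "resolvent \<gamma> A z = {y. z \<in> (\<lambda>u. y + \<gamma> *\<^sub>R u) ` A y}"

text \<open>
  The Bochner integral of the library requires a second-countable codomain, whereas the Hilbert
  space here need not be separable. The usual convention is followed that a random variable in
  such a space is a Borel measurable map with separable range, i.e. a pointwise limit of simple
  functions; this is what makes sums of random variables measurable. On second-countable types the
  two notions below coincide with \<open>borel_measurable\<close> and \<open>has_bochner_integral\<close>.
\<close>

definition random_var :: "'a measure \<Rightarrow> ('a \<Rightarrow> 'h::real_normed_vector) \<Rightarrow> bool" where
  "random_var M X \<longleftrightarrow> X \<in> borel_measurable M \<and> separable_space (top_of_set (X ` space M))"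

definition has_vec_integral :: "'a measure \<Rightarrow> ('a \<Rightarrow> 'h::real_normed_vector) \<Rightarrow> 'h \<Rightarrow> bool" where
  "has_vec_integral M X I \<longleftrightarrow> random_var M X \<and>
     (\<exists>s. (\<forall>i. Bochner_Integration.simple_bochner_integrable M (s i)) \<and>
          (\<lambda>i. \<integral>\<^sup>+x. ennreal (norm (X x - s i x)) \<partial>M) \<longlonglongrightarrow> 0 \<and>
          (\<lambda>i. Bochner_Integration.simple_bochner_integral M (s i)) \<longlonglongrightarrow> I)"

lemma random_var_second_countable:
  fixes X :: "'a \<Rightarrow> 'h::{real_normed_vector, second_countable_topology}"
  shows "random_var M X \<longleftrightarrow> X \<in> borel_measurable M"
proof -
  obtain D where D: "countable D" "D \<subseteq> X ` space M" "X ` space M \<subseteq> closure D"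
    using separable by blast
  have "separable_space (top_of_set (X ` space M))"
    unfolding separable_space_def
    using D by (intro exI[of _ D]) (auto simp: closure_of_subtopology inf_absorb2)
  then show ?thesis
    by (simp add: random_var_def)
qed

lemma has_vec_integral_second_countable:
  fixes X :: "'a \<Rightarrow> 'h::{real_normed_vector, second_countable_topology}"
  shows "has_vec_integral M X I \<longleftrightarrow> has_bochner_integral M X I"
  unfolding has_vec_integral_def random_var_second_countable has_bochner_integral.simps by auto

text \<open>
  \<open>has_cond_exp M F X Y\<close> means that \<open>Y\<close> is a version of the conditional expectation of the
  integrable random variable \<open>X\<close> given \<open>F\<close>; integrability of \<open>X\<close> and \<open>Y\<close> is the case
  \<open>A = space M\<close>. The library provides conditional expectations of real functions only.
\<close>

definition has_cond_exp ::
  "'a measure \<Rightarrow> 'a measure \<Rightarrow> ('a \<Rightarrow> 'h::real_normed_vector) \<Rightarrow> ('a \<Rightarrow> 'h) \<Rightarrow> bool" where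
  "has_cond_exp M F X Y \<longleftrightarrow> random_var F Y \<and>
     (\<forall>A \<in> sets F. \<exists>I. has_vec_integral M (\<lambda>x. indicator A x *\<^sub>R X x) I \<and>
                     has_vec_integral M (\<lambda>x. indicator A x *\<^sub>R Y x) I)"

text \<open>The \<open>\<sigma>\<close>-algebra generated by \<open>w 1, \<dots>, w n\<close>.\<close>

definition gen_sigma :: "'a measure \<Rightarrow> (nat \<Rightarrow> 'a \<Rightarrow> 'h::topological_space) \<Rightarrow> nat \<Rightarrow> 'a measure" where
  "gen_sigma M w n =
     sigma (space M) {w i -` S \<inter> space M | i S. i \<in> {1..n} \<and> S \<in> sets borel}"

definition phi :: "real \<Rightarrow> real \<Rightarrow> real" where
  "phi c t = (if c = 0 then ln t else (t powr c - 1) / c)"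

end

theory Submission
  imports Defs "HOL-Real_Asymp.Real_Asymp"
begin

text \<open>
  One step of the algorithm contracts the mean squared error \<open>s n\<close> up to noise. The forward step
  replaces \<open>w - wbar\<close> by \<open>V - \<gamma> N\<close>, where \<open>V = (w - wbar) - \<gamma> (B w - B wbar)\<close> is a function of the
  present iterate and \<open>N\<close> is the stochastic error, which has conditional mean zero. Hence \<open>V\<close> and \<open>N\<close>
  are orthogonal (\<open>cond_exp_diff_orthogonal\<close>). Cocoercivity and the step size condition absorb
  the part of the variance that depends on \<open>w\<close>, and strong monotonicity of \<open>B\<close> at \<open>wbar\<close> leaves the
  factor \<open>1 - \<epsilon> \<mu> \<gamma>\<close> (\<open>forward_step_bound\<close>). The backward step is a resolvent, which
  contracts by \<open>1 / (1 + \<gamma> \<nu>)\<close> and sends \<open>wbar - \<gamma> B wbar\<close> back to \<open>wbar\<close>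
  (\<open>resolvent_contraction\<close>, \<open>zero_is_fixed_point\<close>). Together these give
  \<open>s (n + 1) \<le> (1 - \<eta> n) * s n + \<tau> * (\<eta> n)\<^sup>2\<close> with \<open>\<eta> n = c * n powr (-\<theta>)\<close>, for all
  \<open>n \<ge> n0\<close> (\<open>stochastic_forward_backward_step\<close>, \<open>contraction_factor_bound\<close>).

  It remains to solve this real recursion. For \<open>\<theta> < 1\<close> the noise of the first half of the indices is
  damped exponentially by the second half, and the noise of the second half stays below a barrier of
  the size of the current step (\<open>recursion_bound_theta_less_one\<close>). For \<open>\<theta> = 1\<close> the product of the
  factors behaves like \<open>n powr (-c)\<close>, and the noise sum is compared with an integral if \<open>c < 2\<close>, and
  bounded by an explicit supersolution if \<open>c \<ge> 2\<close> (\<open>recursion_bound_theta_one\<close>). The rates are read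
  off from these bounds.

  The Hilbert space need not be separable. Measurability of the iterates therefore rests on
  \<open>random_var_Pair\<close>: pairs of Borel maps with separable range are again such maps. Vector-valued
  conditional expectations are used only through inner products with test functions, which are
  approximated by simple ones along a dense sequence (\<open>nearest\<close>).
\<close>

section \<open>Comparing power sums with \<open>phi\<close>\<close>

lemma DERIV_phi:
  assumes "x > 0"
  shows "(phi c has_real_derivative x powr (c - 1)) (at x)"
proof (cases "c = 0")
  case True
  then have "phi c = ln"
    by (auto simp: phi_def fun_eq_iff)
  with True assms show ?thesis
    by (auto intro!: derivative_eq_intros simp: powr_minus divide_inverse)
next
  case False
  then have "phi c = (\<lambda>t. (t powr c - 1) / c)"
    by (auto simp: phi_def fun_eq_iff)
  with False assms show ?thesis
    by (auto intro!: derivative_eq_intros)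
qed

lemma phi_one [simp]: "phi c 1 = 0"
  by (simp add: phi_def)

text \<open>
  Sums of powers are compared with integrals of \<open>x powr (c - 1)\<close>. One unit step of the
  antiderivative \<open>phi c\<close> suffices for both directions, since the integrand is nonincreasing when
  \<open>c \<le> 1\<close>; all sums are then handled by telescoping, without any integral.
\<close>

lemma phi_step:
  assumes "x > 0" "c \<le> 1"
  shows "(x + 1) powr (c - 1) \<le> phi c (x + 1) - phi c x"
    and "phi c (x + 1) - phi c x \<le> x powr (c - 1)"
proof -
  have "\<exists>u. x < u \<and> u < x + 1 \<and> phi c (x + 1) - phi c x = (x + 1 - x) * u powr (c - 1)"
    using assms(1) by (intro MVT2) (auto intro!: DERIV_phi)
  then obtain u where u: "x < u" "u < x + 1" "phi c (x + 1) - phi c x = u powr (c - 1)"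
    by auto
  show "(x + 1) powr (c - 1) \<le> phi c (x + 1) - phi c x"
    using u assms by (simp add: powr_mono2')
  show "phi c (x + 1) - phi c x \<le> x powr (c - 1)"
    using u assms by (simp add: powr_mono2')
qed

lemma phi_mono:
  assumes "0 < x" "x \<le> y"
  shows "phi c x \<le> phi c y"
  using assms by (intro DERIV_nonneg_imp_nondecreasing[of x y "phi c"])
    (auto intro!: exI[of _ "_ powr (c - 1)"] DERIV_phi)

lemma phi_nonneg: "1 \<le> x \<Longrightarrow> 0 \<le> phi c x"
  using phi_mono[of 1 x c] by simp

lemma phi_le_self:
  assumes "c \<le> 1" "1 \<le> x"
  shows "phi c x \<le> x - 1"
proof (cases "x = 1")
  case False
  with assms have "\<exists>u. 1 < u \<and> u < x \<and> phi c x - phi c 1 = (x - 1) * u powr (c - 1)"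
    by (intro MVT2) (auto intro!: DERIV_phi)
  then obtain u where u: "1 < u" "phi c x = (x - 1) * u powr (c - 1)"
    by auto
  have "u powr (c - 1) \<le> 1 powr (c - 1)"
    using u assms by (intro powr_mono2') auto
  then show ?thesis
    using u assms mult_left_mono[of "u powr (c - 1)" 1 "x - 1"] by simp
qed simp

lemma sum_powr_le_phi:
  fixes a b :: nat
  assumes "c \<le> 1" "2 \<le> a" "a \<le> Suc b"
  shows "(\<Sum>k = a..b. real k powr (c - 1)) \<le> phi c b"
proof -
  have "a - 1 \<le> b" "a = Suc (a - 1)" using assms by auto
  then show ?thesis
  proof (induction b rule: dec_induct)
    case base
    then show ?case using assms by (auto intro!: phi_nonneg)
  next
    case (step b)
    have "(\<Sum>k = a..Suc b. real k powr (c - 1))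
        = (\<Sum>k = a..b. real k powr (c - 1)) + (real b + 1) powr (c - 1)"
      using step by (simp add: add.commute)
    also have "\<dots> \<le> phi c b + (phi c (real b + 1) - phi c b)"
      using step assms by (intro add_mono phi_step(1)) auto
    finally show ?case by (simp add: add.commute)
  qed
qed

text \<open>
  \<open>1 - x \<le> exp (- x)\<close> turns the product into the exponential of a sum, and that sum dominates
  the integral of \<open>x powr (-\<theta>)\<close> from \<open>a\<close> to \<open>b\<close>.
\<close>

lemma prod_le_exp_phi:
  fixes a b :: nat
  assumes "1 \<le> a" "a \<le> b" "0 \<le> \<theta>" "0 \<le> c"
    and small: "\<And>k. a \<le> k \<Longrightarrow> c * real k powr (-\<theta>) \<le> 1"
  shows "(\<Prod>k = a..<b. 1 - c * real k powr (-\<theta>)) \<le> exp (- c * (phi (1 - \<theta>) b - phi (1 - \<theta>) a))"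
  using \<open>a \<le> b\<close>
proof (induction b rule: dec_induct)
  case (step b)
  have "1 - c * real b powr (-\<theta>) \<le> exp (- c * real b powr (-\<theta>))"
    using exp_ge_add_one_self[of "- c * real b powr (-\<theta>)"] by simp
  also have "\<dots> \<le> exp (- c * (phi (1 - \<theta>) (real b + 1) - phi (1 - \<theta>) b))"
    using phi_step(2)[of b "1 - \<theta>"] step assms by (auto intro!: mult_left_mono)
  finally have factor: "1 - c * real b powr (-\<theta>) \<le> \<dots>" .
  have "(\<Prod>k = a..<Suc b. 1 - c * real k powr (-\<theta>))
      = (\<Prod>k = a..<b. 1 - c * real k powr (-\<theta>)) * (1 - c * real b powr (-\<theta>))"
    using step by simp
  also have "\<dots> \<le> exp (- c * (phi (1 - \<theta>) b - phi (1 - \<theta>) a))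
      * exp (- c * (phi (1 - \<theta>) (real b + 1) - phi (1 - \<theta>) b))"
    using step factor small by (intro mult_mono) (auto intro!: prod_nonneg)
  also have "\<dots> = exp (- c * (phi (1 - \<theta>) (Suc b) - phi (1 - \<theta>) a))"
    by (simp add: exp_add[symmetric] algebra_simps)
  finally show ?case .
qed simp

section \<open>Solving the recursion for the mean squared error\<close>

text \<open>
  On early indices the accumulated noise is estimated crudely: each new term is merely not
  amplified by the later factors in \<open>[0, 1]\<close>.
\<close>

lemma recursion_sum_bound:
  fixes s \<eta> :: "nat \<Rightarrow> real"
  assumes rec: "\<And>k. a \<le> k \<Longrightarrow> k < b \<Longrightarrow> s (Suc k) \<le> (1 - \<eta> k) * s k + \<tau> * (\<eta> k)\<^sup>2"
    and \<eta>: "\<And>k. a \<le> k \<Longrightarrow> k < b \<Longrightarrow> 0 \<le> \<eta> k \<and> \<eta> k \<le> 1"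
    and "0 \<le> \<tau>" "a \<le> b"
  shows "s b \<le> (\<Prod>k = a..<b. 1 - \<eta> k) * s a + \<tau> * (\<Sum>k = a..<b. (\<eta> k)\<^sup>2)"
  using \<open>a \<le> b\<close> rec \<eta>
proof (induction b rule: dec_induct)
  case (step b)
  have \<eta>b: "0 \<le> \<eta> b" "\<eta> b \<le> 1" using step by auto
  have "s (Suc b) \<le> (1 - \<eta> b) * s b + \<tau> * (\<eta> b)\<^sup>2"
    using step by auto
  also have "\<dots> \<le> (1 - \<eta> b) * ((\<Prod>k = a..<b. 1 - \<eta> k) * s a + \<tau> * (\<Sum>k = a..<b. (\<eta> k)\<^sup>2))
      + \<tau> * (\<eta> b)\<^sup>2"
    using step \<eta>b by (intro add_right_mono mult_left_mono) auto
  also have "\<dots> \<le> (1 - \<eta> b) * ((\<Prod>k = a..<b. 1 - \<eta> k) * s a)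
      + \<tau> * (\<Sum>k = a..<b. (\<eta> k)\<^sup>2) + \<tau> * (\<eta> b)\<^sup>2"
  proof -
    have "0 \<le> \<eta> b * (\<tau> * (\<Sum>k = a..<b. (\<eta> k)\<^sup>2))"
      using \<eta>b \<open>0 \<le> \<tau>\<close> by (intro mult_nonneg_nonneg sum_nonneg) auto
    then show ?thesis
      by (simp add: algebra_simps)
  qed
  finally show ?case
    using step by (simp add: algebra_simps)
qed simp

text \<open>
  On late indices the noise is controlled by a barrier. Since
  \<open>\<tau> * (\<eta> k)\<^sup>2 \<le> \<eta> k * (\<tau> * h)\<close>, the recursion contracts the excess of \<open>s\<close> over the level
  \<open>\<tau> * h\<close>, where \<open>h\<close> bounds the step sizes.
\<close>

lemma recursion_level_bound:
  fixes s \<eta> :: "nat \<Rightarrow> real"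
  assumes rec: "\<And>k. a \<le> k \<Longrightarrow> k < b \<Longrightarrow> s (Suc k) \<le> (1 - \<eta> k) * s k + \<tau> * (\<eta> k)\<^sup>2"
    and \<eta>: "\<And>k. a \<le> k \<Longrightarrow> k < b \<Longrightarrow> 0 \<le> \<eta> k \<and> \<eta> k \<le> h" "h \<le> 1"
    and "0 \<le> \<tau>" "a \<le> b"
  shows "s b - \<tau> * h \<le> (\<Prod>k = a..<b. 1 - \<eta> k) * (s a - \<tau> * h)"
  using \<open>a \<le> b\<close> rec \<eta>
proof (induction b rule: dec_induct)
  case (step b)
  have \<eta>b: "0 \<le> \<eta> b" "\<eta> b \<le> h" "\<eta> b \<le> 1" using step by force+
  have "s (Suc b) - \<tau> * h \<le> (1 - \<eta> b) * s b + \<tau> * (\<eta> b)\<^sup>2 - \<tau> * h"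
    using step by auto
  also have "\<dots> \<le> (1 - \<eta> b) * (s b - \<tau> * h)"
    using mult_left_mono[OF mult_left_mono[OF \<eta>b(2) \<eta>b(1)] \<open>0 \<le> \<tau>\<close>]
    by (simp add: algebra_simps power2_eq_square)
  also have "\<dots> \<le> (1 - \<eta> b) * ((\<Prod>k = a..<b. 1 - \<eta> k) * (s a - \<tau> * h))"
    using step \<eta>b by (intro mult_left_mono) auto
  finally show ?case
    using step by (simp add: algebra_simps)
qed simp

text \<open>
  The index range is split at \<open>m = (n + 1) div 2\<close>. Up to \<open>m\<close> the noise adds up to a
  \<open>phi (1 - 2 * \<theta>)\<close> term, which the product over \<open>m, \<dots>, n\<close> then damps by the factor
  \<open>exp (- c * t * (n + 1) powr (1 - \<theta>) / (1 - \<theta>))\<close>, with \<open>t = 1 - 2 powr (\<theta> - 1)\<close>: this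
  constant appears because the exponent loses the part of the integral below \<open>(n + 1) / 2\<close>. After
  \<open>m\<close> only the barrier level \<open>\<tau> * c * m powr (-\<theta>)\<close> remains, and \<open>m \<ge> (n - 2) / 2\<close>.
\<close>

lemma recursion_bound_theta_less_one:
  fixes s :: "nat \<Rightarrow> real" and n0 n :: nat
  assumes rec: "\<And>k. n0 \<le> k \<Longrightarrow>
      s (Suc k) \<le> (1 - c * real k powr (-\<theta>)) * s k + \<tau> * (c * real k powr (-\<theta>))\<^sup>2"
    and small: "\<And>k. n0 \<le> k \<Longrightarrow> c * real k powr (-\<theta>) \<le> 1"
    and "0 < c" "0 \<le> \<tau>" "2 \<le> n0" "0 < \<theta>" "\<theta> < 1" "0 \<le> s n0" "2 * n0 \<le> n"
  shows "s (n + 1) \<le>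
      (\<tau> * c\<^sup>2 * phi (1 - 2 * \<theta>) (real n) + s n0 * exp (c * real n0 powr (1 - \<theta>) / (1 - \<theta>)))
        * exp (- c * (1 - 2 powr (\<theta> - 1)) * real (n + 1) powr (1 - \<theta>) / (1 - \<theta>))
      + \<tau> * 2 powr \<theta> * c / (real n - 2) powr \<theta>"
proof -
  define \<eta> where "\<eta> k = c * real k powr (-\<theta>)" for k :: nat
  define P where "P a b = (\<Prod>k = a..<b. 1 - \<eta> k)" for a b
  define q where "q = 1 - \<theta>"
  define E where "E = exp (- c * (1 - 2 powr (-q)) * real (n + 1) powr q / q)"
  have q: "0 < q" "q \<le> 1" using assms by (auto simp: q_def)
  define m where "m = (n + 1) div 2"
  have m: "n0 \<le> m" "2 * m \<le> n + 1" "n \<le> 2 * m" "m \<le> n"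
    using assms by (auto simp: m_def)
  have \<eta>: "0 \<le> \<eta> k \<and> \<eta> k \<le> 1" if "n0 \<le> k" for k
    using small[OF that] \<open>0 < c\<close> by (auto simp: \<eta>_def)
  have \<eta>_decr: "\<eta> k \<le> \<eta> m" if "m \<le> k" for k
    using that m assms by (auto simp: \<eta>_def intro!: mult_left_mono powr_mono2')
  have P: "0 \<le> P a b" if "n0 \<le> a" for a b
    using that \<eta> by (auto simp: P_def intro!: prod_nonneg)
  have P_exp: "P a b \<le> exp (c * real a powr q / q) * exp (- c * real b powr q / q)"
    if "n0 \<le> a" "a \<le> b" for a b
  proof -
    have "P a b \<le> exp (- c * (phi q b - phi q a))"
      unfolding P_def \<eta>_def q_def using that assms small by (intro prod_le_exp_phi) auto
    also have "- c * (phi q b - phi q a) = c * real a powr q / q + - c * real b powr q / q"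
      using q by (simp add: phi_def field_simps)
    finally show ?thesis by (simp only: exp_add)
  qed
  have split_P: "P m (n + 1) * P n0 m = P n0 (n + 1)"
    unfolding P_def using m by (subst mult.commute, intro prod.atLeastLessThan_concat) auto
  have E1: "exp (- c * real (n + 1) powr q / q) \<le> E"
    using q \<open>0 < c\<close> unfolding E_def
    by (auto intro!: divide_right_mono mult_right_mono)
  have half: "real m powr q \<le> 2 powr (-q) * real (n + 1) powr q"
  proof -
    have "real m powr q \<le> (real (n + 1) / 2) powr q"
      using m q by (intro powr_mono2) auto
    also have "\<dots> = 2 powr (-q) * real (n + 1) powr q"
      by (simp add: powr_divide powr_minus_divide)
    finally show ?thesis .
  qed
  have E2: "P m (n + 1) \<le> E"
  proof -
    have "P m (n + 1) \<le> exp (c * real m powr q / q + - c * real (n + 1) powr q / q)"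
      using P_exp[of m "n + 1"] m by (simp only: exp_add)
    also have "\<dots> \<le> E"
    proof -
      have "c * real m powr q / q \<le> c * (2 powr (-q) * real (n + 1) powr q) / q"
        using half \<open>0 < c\<close> q by (intro divide_right_mono mult_left_mono) auto
      then show ?thesis
        unfolding E_def by (simp add: algebra_simps diff_divide_distrib)
    qed
    finally show ?thesis .
  qed
  have sum: "(\<Sum>k = n0..<m. (\<eta> k)\<^sup>2) \<le> c\<^sup>2 * phi (1 - 2 * \<theta>) n"
  proof -
    have "(\<Sum>k = n0..<m. (\<eta> k)\<^sup>2) = c\<^sup>2 * (\<Sum>k = n0..<m. real k powr ((1 - 2 * \<theta>) - 1))"
      unfolding sum_distrib_left \<eta>_def
      by (intro sum.cong) (auto simp: power_mult_distrib power2_eq_square powr_add[symmetric])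
    also have "(\<Sum>k = n0..<m. real k powr ((1 - 2 * \<theta>) - 1))
        \<le> (\<Sum>k = n0..n. real k powr ((1 - 2 * \<theta>) - 1))"
      using m by (intro sum_mono2) auto
    also have "\<dots> \<le> phi (1 - 2 * \<theta>) n"
      using assms by (intro sum_powr_le_phi) auto
    finally show ?thesis by (simp add: mult_left_mono)
  qed
  have tail: "\<eta> m \<le> 2 powr \<theta> * c / (real n - 2) powr \<theta>"
  proof -
    have "\<eta> m \<le> c * ((real n - 2) / 2) powr (-\<theta>)"
      unfolding \<eta>_def using m assms by (intro mult_left_mono powr_mono2') auto
    also have "\<dots> = 2 powr \<theta> * c / (real n - 2) powr \<theta>"
      using assms by (simp add: powr_divide powr_minus_divide)
    finally show ?thesis .
  qed
  have "s m \<le> P n0 m * s n0 + \<tau> * (\<Sum>k = n0..<m. (\<eta> k)\<^sup>2)"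
    unfolding P_def using rec \<eta> m assms by (intro recursion_sum_bound) (auto simp: \<eta>_def)
  also have "\<dots> \<le> P n0 m * s n0 + \<tau> * (c\<^sup>2 * phi (1 - 2 * \<theta>) n)"
    using sum \<open>0 \<le> \<tau>\<close> by (intro add_left_mono mult_left_mono)
  finally have first: "s m \<le> \<dots>" .
  have "s (n + 1) - \<tau> * \<eta> m \<le> P m (n + 1) * (s m - \<tau> * \<eta> m)"
    unfolding P_def using rec \<eta> \<eta>_decr m assms
    by (intro recursion_level_bound) (auto simp: \<eta>_def)
  also have "\<dots> \<le> P m (n + 1) * s m"
    using P m \<eta> \<open>0 \<le> \<tau>\<close> by (intro mult_left_mono) auto
  also have "\<dots> \<le> P m (n + 1) * (P n0 m * s n0 + \<tau> * (c\<^sup>2 * phi (1 - 2 * \<theta>) n))"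
    using first P m by (intro mult_left_mono) auto
  also have "\<dots> = P n0 (n + 1) * s n0 + P m (n + 1) * (\<tau> * c\<^sup>2 * phi (1 - 2 * \<theta>) n)"
    using split_P by (simp add: distrib_left mult.assoc[symmetric])
  also have "\<dots> \<le> (exp (c * real n0 powr q / q) * E) * s n0 + E * (\<tau> * c\<^sup>2 * phi (1 - 2 * \<theta>) n)"
  proof -
    have "P n0 (n + 1) \<le> exp (c * real n0 powr q / q) * exp (- c * real (n + 1) powr q / q)"
      using P_exp[of n0 "n + 1"] m by auto
    also have "\<dots> \<le> exp (c * real n0 powr q / q) * E"
      using E1 by (intro mult_left_mono) auto
    finally show ?thesis
      using E2 assms
      by (intro add_mono mult_right_mono mult_nonneg_nonneg phi_nonneg) auto
  qed
  finally have "s (n + 1) \<le> (\<tau> * c\<^sup>2 * phi (1 - 2 * \<theta>) n + s n0 * exp (c * real n0 powr q / q)) * E + \<tau> * \<eta> m"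
    by (simp add: algebra_simps)
  also have "\<dots> \<le> (\<tau> * c\<^sup>2 * phi (1 - 2 * \<theta>) n + s n0 * exp (c * real n0 powr q / q)) * E
      + \<tau> * (2 powr \<theta> * c / (real n - 2) powr \<theta>)"
    using tail \<open>0 \<le> \<tau>\<close> by (intro add_left_mono mult_left_mono)
  finally show ?thesis
    by (simp add: E_def q_def mult.assoc)
qed

text \<open>
  For step sizes \<open>c / n\<close> the contraction factor acts like \<open>n powr (-c)\<close>, so multiplying the
  recursion by \<open>n powr c\<close> removes it.
\<close>

lemma one_minus_le_powr:
  fixes n :: nat
  assumes "1 \<le> n" "0 \<le> c"
  shows "1 - c / real n \<le> (real n / real (n + 1)) powr c"
proof -
  have "1 - c / real n \<le> exp (- c / real n)"
    using exp_ge_add_one_self[of "- c / real n"] by simp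
  also have "\<dots> \<le> exp (c * ln (real n / real (n + 1)))"
  proof -
    have "ln (real (n + 1) / real n) \<le> real (n + 1) / real n - 1"
      using assms by (intro ln_le_minus_one) auto
    then have "- (1 / real n) \<le> ln (real n / real (n + 1))"
      using assms by (simp add: ln_div field_simps)
    then show ?thesis
      using mult_left_mono[of "- (1 / real n)" "ln (real n / real (n + 1))" c] assms by simp
  qed
  also have "\<dots> = (real n / real (n + 1)) powr c"
    using assms by (simp add: powr_def)
  finally show ?thesis .
qed

text \<open>
  For \<open>c < 2\<close> the sequence \<open>s n * n powr c\<close> satisfies a telescoping inequality, and the noise
  sum is compared with the integral of the decreasing function \<open>x powr (c - 2)\<close>.

  For \<open>c > 2\<close> that function increases and the sum exceeds the integral for large \<open>n\<close>, so the
  comparison breaks down. For \<open>c \<ge> 2\<close>, however, \<open>1 / ((c - 1) * n)\<close> is a supersolution of the noise recursion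
  \<open>v (n + 1) = (1 - c / n) * v n + 1 / n\<^sup>2\<close>, and it lies below the claimed term because
  \<open>n \<ge> 2 * n0\<close> and \<open>n powr (1 - c) \<le> 1 / n\<close> leave enough room in the factor
  \<open>(1 + 1 / n0) powr c\<close>. The hypothesis \<open>c \<le> n0\<close> keeps all the factors \<open>1 - c / n\<close>
  nonnegative.
\<close>

lemma recursion_bound_theta_one:
  fixes s :: "nat \<Rightarrow> real" and n0 n :: nat
  assumes rec: "\<And>k. n0 \<le> k \<Longrightarrow> s (Suc k) \<le> (1 - c / real k) * s k + \<tau> * (c / real k)\<^sup>2"
    and "0 < c" "c \<le> real n0" "0 \<le> \<tau>" "2 \<le> n0" "0 \<le> s n0" "2 * n0 \<le> n"
  shows "s (n + 1) \<le> s n0 * (real n0 / real (n + 1)) powr c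
      + \<tau> * c\<^sup>2 / real (n + 1) powr c * (1 + 1 / real n0) powr c * phi (c - 1) (real n)"
proof (cases "c < 2")
  case True
  have telescope: "s b * real b powr c
      \<le> s n0 * real n0 powr c + \<tau> * c\<^sup>2 * (\<Sum>k = n0..<b. real (k + 1) powr c / (real k)\<^sup>2)"
    if "n0 \<le> b" for b
    using that
  proof (induction b rule: dec_induct)
    case (step b)
    define R where "R = s n0 * real n0 powr c
      + \<tau> * c\<^sup>2 * (\<Sum>k = n0..<b. real (k + 1) powr c / (real k)\<^sup>2)"
    have nn: "0 \<le> 1 - c / real b" "0 < real b"
      using step assms by (auto simp: field_simps)
    have R: "0 \<le> R" "s b * real b powr c \<le> R"
      using assms step by (auto simp: R_def intro!: add_nonneg_nonneg mult_nonneg_nonneg sum_nonneg)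
    have "(1 - c / real b) * s b \<le> (1 - c / real b) * (R / real b powr c)"
      using R nn by (intro mult_left_mono) (auto simp: pos_le_divide_eq)
    also have "\<dots> \<le> (real b / real (b + 1)) powr c * (R / real b powr c)"
      using one_minus_le_powr[of b c] step assms R by (intro mult_right_mono divide_nonneg_nonneg) auto
    also have "\<dots> = R / real (b + 1) powr c"
      using nn by (simp add: powr_divide)
    finally have contraction: "(1 - c / real b) * s b \<le> R / real (b + 1) powr c" .
    have "s (Suc b) * real (Suc b) powr c
        \<le> (R / real (b + 1) powr c + \<tau> * (c / real b)\<^sup>2) * real (Suc b) powr c"
      using rec[of b] step contraction by (intro mult_right_mono) auto
    also have "\<dots> = R + \<tau> * c\<^sup>2 * (real (b + 1) powr c / (real b)\<^sup>2)"
      by (simp add: distrib_right power_divide)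
    finally show ?case
      using step by (simp add: R_def algebra_simps)
  qed simp
  have "(\<Sum>k = n0..<n + 1. real (k + 1) powr c / (real k)\<^sup>2)
      \<le> (\<Sum>k = n0..n. (1 + 1 / real n0) powr c * real k powr ((c - 1) - 1))"
  proof (intro order.trans[OF eq_refl[OF sum.cong] sum_mono])
    fix k assume k: "k \<in> {n0..n}"
    then have pos: "0 < real k" using assms by auto
    have "real (k + 1) powr c / (real k)\<^sup>2 = ((1 + 1 / real k) * real k) powr c / real k powr 2"
    proof -
      have "(1 + 1 / real k) * real k = real (k + 1)"
        using pos by (simp add: field_simps)
      with pos show ?thesis by simp
    qed
    also have "\<dots> = (1 + 1 / real k) powr c * real k powr ((c - 1) - 1)"
      using pos by (simp add: powr_mult powr_diff)
    also have "\<dots> \<le> (1 + 1 / real n0) powr c * real k powr ((c - 1) - 1)"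
      using k assms by (intro mult_right_mono powr_mono2) (auto simp: frac_le)
    finally show "real (k + 1) powr c / (real k)\<^sup>2 \<le> \<dots>" .
  qed auto
  also have "\<dots> \<le> (1 + 1 / real n0) powr c * phi (c - 1) n"
    unfolding sum_distrib_left[symmetric] using True assms
    by (intro mult_left_mono sum_powr_le_phi) auto
  finally have noise: "(\<Sum>k = n0..<n + 1. real (k + 1) powr c / (real k)\<^sup>2)
      \<le> (1 + 1 / real n0) powr c * phi (c - 1) n" .
  have "s (n + 1) * real (n + 1) powr c
      \<le> s n0 * real n0 powr c + \<tau> * c\<^sup>2 * ((1 + 1 / real n0) powr c * phi (c - 1) n)"
    using telescope[of "n + 1"] mult_left_mono[OF noise, of "\<tau> * c\<^sup>2"] assms by simp
  then have "s (n + 1)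
      \<le> (s n0 * real n0 powr c + \<tau> * c\<^sup>2 * ((1 + 1 / real n0) powr c * phi (c - 1) n)) / real (n + 1) powr c"
    by (simp add: pos_le_divide_eq)
  then show ?thesis
    by (simp add: powr_divide add_divide_distrib mult.assoc)
next
  case False
  \<comment> \<open>The initial value decays like \<open>b powr (-c)\<close>, the noise stays below the supersolution.\<close>
  have super: "s b \<le> s n0 * (real n0 / real b) powr c + \<tau> * c\<^sup>2 / ((c - 1) * real b)"
    if "n0 \<le> b" for b
    using that
  proof (induction b rule: dec_induct)
    case base
    then show ?case using assms False by simp
  next
    case (step b)
    have nn: "0 \<le> 1 - c / real b" "0 < real b"
      using step assms by (auto simp: field_simps)
    have "(1 - c / real b) * (s n0 * (real n0 / real b) powr c)
        \<le> (real b / real (b + 1)) powr c * (s n0 * (real n0 / real b) powr c)"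
      using one_minus_le_powr[of b c] step assms by (intro mult_right_mono) auto
    also have "\<dots> = s n0 * (real n0 / real (b + 1)) powr c"
      using nn by (simp add: powr_divide)
    finally have start: "(1 - c / real b) * (s n0 * (real n0 / real b) powr c)
        \<le> s n0 * (real n0 / real (b + 1)) powr c" .
    have "(1 - c / real b) * (1 / ((c - 1) * real b)) + 1 / (real b)\<^sup>2
        = (real b - 1) / ((c - 1) * (real b)\<^sup>2)"
      using False nn by (simp add: divide_simps power2_eq_square)
    also have "\<dots> \<le> 1 / ((c - 1) * real (b + 1))"
    proof -
      have "(real b - 1) * real (b + 1) \<le> (real b)\<^sup>2"
        by (simp add: algebra_simps power2_eq_square)
      then have "real b - 1 \<le> (real b)\<^sup>2 / real (b + 1)"
        by (simp add: pos_le_divide_eq)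
      then have "(real b - 1) / (real b)\<^sup>2 / (c - 1) \<le> (real b)\<^sup>2 / real (b + 1) / (real b)\<^sup>2 / (c - 1)"
        using False by (intro divide_right_mono) auto
      then show ?thesis
        using nn by (simp add: mult.commute)
    qed
    finally have "\<tau> * c\<^sup>2 * ((1 - c / real b) * (1 / ((c - 1) * real b)) + 1 / (real b)\<^sup>2)
        \<le> \<tau> * c\<^sup>2 * (1 / ((c - 1) * real (b + 1)))"
      using assms by (intro mult_left_mono) auto
    then have "(1 - c / real b) * (\<tau> * c\<^sup>2 / ((c - 1) * real b)) + \<tau> * (c / real b)\<^sup>2
        \<le> \<tau> * c\<^sup>2 / ((c - 1) * real (b + 1))"
      by (simp add: algebra_simps power_divide)
    moreover have "s (Suc b) \<le> (1 - c / real b) * (s n0 * (real n0 / real b) powr c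
        + \<tau> * c\<^sup>2 / ((c - 1) * real b)) + \<tau> * (c / real b)\<^sup>2"
      using rec[of b] step mult_left_mono[OF step.IH nn(1)] by auto
    ultimately show ?case
      using start by (simp add: distrib_left)
  qed
  have pos: "0 < real n" "0 < real n0" using assms by auto
  have "real n powr (1 - c) \<le> real n powr (-1)"
    using False assms by (intro powr_mono) auto
  also have "\<dots> \<le> 1 / (real n0 + 1)"
    using assms by (simp add: powr_minus divide_simps)
  finally have "1 \<le> (1 + 1 / real n0) * (1 - real n powr (1 - c))"
    using pos by (simp add: field_simps)
  then have "(1 + 1 / real n) powr (c - 1) * 1
      \<le> (1 + 1 / real n0) powr (c - 1) * ((1 + 1 / real n0) * (1 - real n powr (1 - c)))"
    using False assms by (intro mult_mono powr_mono2 add_left_mono frac_le) auto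
  also have "\<dots> = (1 + 1 / real n0) powr c * (1 - real n powr (1 - c))"
  proof -
    have "0 < 1 + 1 / real n0"
      using pos by (simp add: add_pos_pos)
    then have "(1 + 1 / real n0) powr c = (1 + 1 / real n0) powr (c - 1) * (1 + 1 / real n0)"
      using powr_add[of "1 + 1 / real n0" "c - 1" 1] by simp
    then show ?thesis
      by (simp only: mult.assoc)
  qed
  finally have "(1 + 1 / real n) powr (c - 1) * real n powr (c - 1)
      \<le> (1 + 1 / real n0) powr c * (1 - real n powr (1 - c)) * real n powr (c - 1)"
    by (intro mult_right_mono) auto
  also have "(1 + 1 / real n) powr (c - 1) * real n powr (c - 1) = real (n + 1) powr (c - 1)"
  proof -
    have "(1 + 1 / real n) powr (c - 1) * real n powr (c - 1) = ((1 + 1 / real n) * real n) powr (c - 1)"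
      by (rule powr_mult[symmetric])
    also have "(1 + 1 / real n) * real n = real (n + 1)"
      using pos by (simp add: field_simps)
    finally show ?thesis .
  qed
  also have "(1 + 1 / real n0) powr c * (1 - real n powr (1 - c)) * real n powr (c - 1)
      = (1 + 1 / real n0) powr c * (real n powr (c - 1) - 1)"
    using pos by (simp add: algebra_simps flip: powr_add)
  finally have "real (n + 1) powr (c - 1) / real (n + 1) powr c / (c - 1)
      \<le> (1 + 1 / real n0) powr c * (real n powr (c - 1) - 1) / real (n + 1) powr c / (c - 1)"
    using False by (intro divide_right_mono) auto
  moreover have "real (n + 1) powr (c - 1) / real (n + 1) powr c / (c - 1) = 1 / ((c - 1) * real (n + 1))"
    by (simp add: powr_diff)
  moreover have "phi (c - 1) n = (real n powr (c - 1) - 1) / (c - 1)"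
    using False by (simp add: phi_def)
  ultimately have "1 / ((c - 1) * real (n + 1))
      \<le> 1 / real (n + 1) powr c * (1 + 1 / real n0) powr c * phi (c - 1) n"
    by simp
  from mult_left_mono[OF this, of "\<tau> * c\<^sup>2"]
  have "\<tau> * c\<^sup>2 / ((c - 1) * real (n + 1))
      \<le> \<tau> * c\<^sup>2 / real (n + 1) powr c * (1 + 1 / real n0) powr c * phi (c - 1) n"
    using assms by (simp add: mult.assoc)
  with super[of "n + 1"] show ?thesis
    using assms by simp
qed

section \<open>Rates of convergence\<close>

lemma bigo_of_shifted_bound:
  fixes s g f :: "nat \<Rightarrow> real"
  assumes "\<And>n. N \<le> n \<Longrightarrow> 0 \<le> s (n + 1)" "\<And>n. N \<le> n \<Longrightarrow> s (n + 1) \<le> g (n + 1)" "g \<in> O(f)"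
  shows "s \<in> O(f)"
proof (rule landau_o.big_trans[OF _ assms(3)], rule bigoI[of _ 1])
  show "eventually (\<lambda>n. norm (s n) \<le> 1 * norm (g n)) at_top"
    using eventually_ge_at_top[of "Suc N"]
  proof eventually_elim
    case (elim n)
    then have "0 \<le> s n" "s n \<le> g n"
      using assms(1,2)[of "n - 1"] by auto
    then show ?case by simp
  qed
qed

text \<open>
  The stretched exponential beats every power of \<open>n\<close>, so the linear bound \<open>phi q x \<le> x - 1\<close> for
  \<open>q \<le> 1\<close> is good enough and only the term \<open>H / (n - 2) powr \<theta>\<close> determines the rate.
\<close>

lemma rate_theta_less_one:
  fixes s :: "nat \<Rightarrow> real"
  assumes nn: "\<And>n. N \<le> n \<Longrightarrow> 0 \<le> s (n + 1)"
    and bound: "\<And>n. N \<le> n \<Longrightarrow> s (n + 1) \<le>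
      (K * phi (1 - 2 * \<theta>) (real n) + L) * exp (- a * real (n + 1) powr (1 - \<theta>) / (1 - \<theta>))
      + H / (real n - 2) powr \<theta>"
    and "0 \<le> K" "0 < a" "0 < \<theta>" "\<theta> < 1"
  shows "s \<in> O(\<lambda>n. real n powr (-\<theta>))"
proof (rule bigo_of_shifted_bound)
  define q where "q = 1 - \<theta>"
  define b where "b = a / q"
  have pos: "0 < q" "0 < b" using assms by (auto simp: q_def b_def)
  let ?g = "\<lambda>n. K * (real n * exp (- b * real n powr q)) + L * exp (- b * real n powr q)
    + H * (real n - 3) powr (-\<theta>)"
  have "(\<lambda>n. real n * exp (- b * real n powr q)) \<in> O(\<lambda>n. real n powr (-\<theta>))"
    using pos \<open>0 < \<theta>\<close> by real_asymp
  moreover have "(\<lambda>n. exp (- b * real n powr q)) \<in> O(\<lambda>n. real n powr (-\<theta>))"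
    using pos \<open>0 < \<theta>\<close> by real_asymp
  moreover have "(\<lambda>n. (real n - 3) powr (-\<theta>)) \<in> O(\<lambda>n. real n powr (-\<theta>))"
    using \<open>0 < \<theta>\<close> by real_asymp
  ultimately show "?g \<in> O(\<lambda>n. real n powr (-\<theta>))"
    by (intro sum_in_bigo landau_o.big.cmult_in_iff'[THEN iffD2, rotated]) auto
  show "s (n + 1) \<le> ?g (n + 1)" if "max N 1 \<le> n" for n
  proof -
    have "phi (1 - 2 * \<theta>) n \<le> real (n + 1)"
      using phi_le_self[of "1 - 2 * \<theta>" n] that assms by simp
    then have "(K * phi (1 - 2 * \<theta>) n + L) * exp (- b * real (n + 1) powr q)
        \<le> (K * real (n + 1) + L) * exp (- b * real (n + 1) powr q)"
      using assms by (intro mult_right_mono add_right_mono mult_left_mono) auto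
    then show ?thesis
      using bound[of n] that by (simp add: b_def q_def powr_minus divide_inverse algebra_simps)
  qed
  show "0 \<le> s (n + 1)" if "max N 1 \<le> n" for n
    using nn that by simp
qed

text \<open>
  The two competing orders are \<open>n powr (-c)\<close>, from the initial value, and
  \<open>n powr (-c) * phi (c - 1) n\<close>, from the noise. The sign of \<open>c - 1\<close> decides whether \<open>phi (c - 1)\<close> is
  bounded, logarithmic or of order \<open>n powr (c - 1)\<close>.
\<close>

lemma rate_theta_one:
  fixes s :: "nat \<Rightarrow> real"
  assumes nn: "\<And>n. N \<le> n \<Longrightarrow> 0 \<le> s (n + 1)"
    and bound: "\<And>n. N \<le> n \<Longrightarrow> s (n + 1) \<le>
      K * (L / real (n + 1)) powr c + H / real (n + 1) powr c * phi (c - 1) (real n)"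
    and "0 \<le> L" "0 \<le> H" "0 < c"
  shows "c < 1 \<Longrightarrow> s \<in> O(\<lambda>n. real n powr (-c))"
    and "c = 1 \<Longrightarrow> s \<in> O(\<lambda>n. ln (real n) / real n)"
    and "1 < c \<Longrightarrow> s \<in> O(\<lambda>n. 1 / real n)"
proof -
  define C where "C = K * L powr c"
  have bound': "s (n + 1) \<le> C * real (n + 1) powr (-c) + H * (real (n + 1) powr (-c) * phi (c - 1) (n + 1))"
    if "max N 1 \<le> n" for n
  proof -
    have "phi (c - 1) n \<le> phi (c - 1) (n + 1)"
      using that by (intro phi_mono) auto
    then have "H / real (n + 1) powr c * phi (c - 1) n \<le> H / real (n + 1) powr c * phi (c - 1) (n + 1)"
      using \<open>0 \<le> H\<close> by (intro mult_left_mono) auto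
    then have "s (n + 1) \<le> K * (L / real (n + 1)) powr c + H / real (n + 1) powr c * phi (c - 1) (n + 1)"
      using bound[of n] that by linarith
    then show ?thesis
      using \<open>0 \<le> L\<close> by (simp add: C_def powr_divide powr_minus_divide)
  qed
  have rate: "s \<in> O(f)"
    if "(\<lambda>n. real n powr (-c)) \<in> O(f)" "(\<lambda>n. real n powr (-c) * phi (c - 1) n) \<in> O(f)"
    for f :: "nat \<Rightarrow> real"
  proof (rule bigo_of_shifted_bound)
    show "(\<lambda>n. C * real n powr (-c) + H * (real n powr (-c) * phi (c - 1) n)) \<in> O(f)"
      using that by (intro sum_in_bigo) auto
    show "0 \<le> s (n + 1)" if "max N 1 \<le> n" for n
      using nn that by simp
  qed (rule bound')
  show "s \<in> O(\<lambda>n. real n powr (-c))" if "c < 1"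
  proof (rule rate)
    show "(\<lambda>n. real n powr (-c) * phi (c - 1) n) \<in> O(\<lambda>n. real n powr (-c))"
      using that \<open>0 < c\<close> unfolding phi_def by simp real_asymp
  qed simp
  show "s \<in> O(\<lambda>n. ln (real n) / real n)" if "c = 1"
    by (rule rate; unfold phi_def that; simp) real_asymp+
  show "s \<in> O(\<lambda>n. 1 / real n)" if "1 < c"
  proof (rule rate)
    show "(\<lambda>n. real n powr (-c)) \<in> O(\<lambda>n. 1 / real n)"
      using that by real_asymp
    show "(\<lambda>n. real n powr (-c) * phi (c - 1) n) \<in> O(\<lambda>n. 1 / real n)"
      using that unfolding phi_def by simp real_asymp
  qed
qed

section \<open>Random variables with separable range\<close>

text \<open>
  A dense set outside \<open>R\<close> also suffices, which is what products and sums of ranges provide. In a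
  general topological space separability does not pass to subspaces; here the balls of
  radius \<open>1 / (n + 1)\<close> around the points of \<open>D\<close> give a countable base.
\<close>

lemma separable_space_top_of_setI:
  fixes R :: "'h::metric_space set"
  assumes "countable D" "R \<subseteq> closure D"
  shows "separable_space (top_of_set R)"
proof (rule second_countable_imp_separable_space)
  let ?b = "\<lambda>(d, n::nat). R \<inter> ball d (1 / Suc n)"
  show "second_countable (top_of_set R)"
    unfolding second_countable_def
  proof (intro exI[of _ "?b ` (D \<times> UNIV)"] conjI ballI allI impI)
    show "countable (?b ` (D \<times> UNIV))"
      using assms by auto
    show "openin (top_of_set R) V" if "V \<in> ?b ` (D \<times> UNIV)" for V
      using that by (auto intro!: openin_open_Int)
    fix U x
    assume "openin (top_of_set R) U \<and> x \<in> U"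
    then obtain T where T: "open T" "U = R \<inter> T" "x \<in> T" "x \<in> R"
      by (auto simp: openin_open)
    then obtain e where e: "e > 0" "ball x e \<subseteq> T"
      by (auto simp: open_contains_ball)
    then obtain n where n: "1 / real (Suc n) < e / 2"
      by (meson half_gt_zero nat_approx_posE)
    obtain d where d: "d \<in> D" "dist d x < 1 / Suc n"
      using T assms closure_approachable[of x D] by (metis divide_pos_pos of_nat_0_less_iff subsetD zero_less_Suc zero_less_one)
    have "ball d (1 / Suc n) \<subseteq> ball x e"
    proof
      fix y assume "y \<in> ball d (1 / Suc n)"
      then have "dist x y < 1 / Suc n + 1 / Suc n"
        using d dist_triangle[of x y d] by (simp add: dist_commute)
      with n show "y \<in> ball x e" by simp
    qed
    with d T e show "\<exists>V \<in> ?b ` (D \<times> UNIV). x \<in> V \<and> V \<subseteq> U"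
      by (intro bexI[of _ "?b (d, n)"]) auto
  qed
qed

lemma random_varI:
  assumes "X \<in> borel_measurable M" "countable D" "X ` space M \<subseteq> closure D"
  shows "random_var M X"
  using assms by (auto simp: random_var_def intro: separable_space_top_of_setI)

lemma random_var_dense:
  assumes "random_var M X"
  obtains D where "countable D" "X ` space M \<subseteq> closure D"
proof -
  obtain D where "countable D" "D \<subseteq> X ` space M" "top_of_set (X ` space M) closure_of D = X ` space M"
    using assms by (auto simp: random_var_def separable_space_def)
  then show thesis
    by (intro that[of D]) (auto simp: closure_of_subtopology inf_absorb2)
qed

lemma random_var_measurable: "random_var M X \<Longrightarrow> X \<in> borel_measurable M"
  by (simp add: random_var_def)

lemma random_var_cong:
  assumes "random_var M X" "\<And>x. x \<in> space M \<Longrightarrow> X x = Y x"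
  shows "random_var M Y"
  using assms measurable_cong[of M X Y borel] by (auto simp: random_var_def cong: image_cong)

lemma random_var_compose:
  assumes X: "random_var M X" and f: "continuous_on (X ` space M) f"
  shows "random_var M (\<lambda>x. f (X x))"
proof -
  have "X \<in> measurable M (restrict_space borel (X ` space M))"
    using X by (intro measurable_restrict_space2) (auto simp: random_var_def)
  then have "(\<lambda>x. f (X x)) \<in> borel_measurable M"
    using borel_measurable_continuous_on_restrict[OF f] by (rule measurable_compose)
  moreover have "separable_space (top_of_set (f ` (X ` space M)))"
    using X f by (intro separable_space_continuous_map_image[of "top_of_set (X ` space M)" _ f])
      (auto simp: random_var_def)
  ultimately show ?thesis
    by (simp add: random_var_def image_image)
qed

text \<open>
  On a nonseparable space the Borel sets of the product are in general not generated by
  rectangles, and sums of Borel maps may fail to be measurable. Separability of the two ranges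
  repairs this: the preimage of an open set is a countable union of preimages of products of balls
  centred in the dense sets.
\<close>

lemma random_var_Pair:
  fixes X :: "'a \<Rightarrow> 'h::real_normed_vector" and Y :: "'a \<Rightarrow> 'k::real_normed_vector"
  assumes X: "random_var M X" and Y: "random_var M Y"
  shows "random_var M (\<lambda>x. (X x, Y x))"
proof -
  obtain D where D: "countable D" "X ` space M \<subseteq> closure D"
    using X by (rule random_var_dense)
  obtain E where E: "countable E" "Y ` space M \<subseteq> closure E"
    using Y by (rule random_var_dense)
  have [measurable]: "X \<in> borel_measurable M" "Y \<in> borel_measurable M"
    using X Y by (auto dest: random_var_measurable)
  show ?thesis
  proof (rule random_varI)
    show "countable (D \<times> E)" "(\<lambda>x. (X x, Y x)) ` space M \<subseteq> closure (D \<times> E)"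
      using D E by (auto simp: closure_Times)
    show "(\<lambda>x. (X x, Y x)) \<in> borel_measurable M"
    proof (rule borel_measurableI)
      fix S :: "('h \<times> 'k) set" assume "open S"
      define I where "I = {(d, e, n::nat). d \<in> D \<and> e \<in> E \<and> ball d (1 / Suc n) \<times> ball e (1 / Suc n) \<subseteq> S}"
      have "I \<subseteq> D \<times> E \<times> UNIV" by (auto simp: I_def)
      then have "countable I"
        using D E by (auto intro: countable_subset)
      have "(\<lambda>x. (X x, Y x)) -` S \<inter> space M
          = (\<Union>(d, e, n) \<in> I. {x \<in> space M. X x \<in> ball d (1 / Suc n) \<and> Y x \<in> ball e (1 / Suc n)})"
      proof (intro equalityI subsetI)
        fix x assume x: "x \<in> (\<lambda>x. (X x, Y x)) -` S \<inter> space M"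
        then obtain U V where UV: "open U" "open V" "(X x, Y x) \<in> U \<times> V" "U \<times> V \<subseteq> S"
          using \<open>open S\<close> by (auto elim!: open_prod_elim)
        obtain a where a: "a > 0" "ball (X x) a \<subseteq> U"
          using UV by (auto simp: open_contains_ball)
        obtain b where b: "b > 0" "ball (Y x) b \<subseteq> V"
          using UV by (auto simp: open_contains_ball)
        have "0 < min a b / 2" using a b by auto
        then obtain n where n: "1 / real (Suc n) < min a b / 2"
          by (rule nat_approx_posE)
        have pos: "0 < 1 / real (Suc n)" by simp
        obtain d where d: "d \<in> D" "dist d (X x) < 1 / Suc n"
          using x D closure_approachable[of "X x" D] pos by blast
        obtain e where e: "e \<in> E" "dist e (Y x) < 1 / Suc n"
          using x E closure_approachable[of "Y x" E] pos by blast
        have "ball d (1 / Suc n) \<subseteq> ball (X x) a"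
        proof
          fix u assume "u \<in> ball d (1 / Suc n)"
          then have "dist (X x) u < 1 / Suc n + 1 / Suc n"
            using d dist_triangle[of "X x" u d] by (simp add: dist_commute)
          with n show "u \<in> ball (X x) a" by simp
        qed
        moreover have "ball e (1 / Suc n) \<subseteq> ball (Y x) b"
        proof
          fix u assume "u \<in> ball e (1 / Suc n)"
          then have "dist (Y x) u < 1 / Suc n + 1 / Suc n"
            using e dist_triangle[of "Y x" u e] by (simp add: dist_commute)
          with n show "u \<in> ball (Y x) b" by simp
        qed
        ultimately have "(d, e, n) \<in> I"
          using a b UV d e by (fastforce simp: I_def)
        then show "x \<in> (\<Union>(d, e, n) \<in> I. {x \<in> space M. X x \<in> ball d (1 / Suc n) \<and> Y x \<in> ball e (1 / Suc n)})"
          using x d e by (intro UN_I[of "(d, e, n)"]) auto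
      qed (auto simp: I_def)
      also have "\<dots> \<in> sets M"
      proof (intro sets.countable_UN' \<open>countable I\<close> image_subsetI, clarify)
        fix d e n
        have "(X -` ball d (1 / Suc n) \<inter> space M) \<inter> (Y -` ball e (1 / Suc n) \<inter> space M) \<in> sets M"
          by (intro sets.Int measurable_sets[where A = borel]) auto
        also have "(X -` ball d (1 / Suc n) \<inter> space M) \<inter> (Y -` ball e (1 / Suc n) \<inter> space M)
            = {x \<in> space M. X x \<in> ball d (1 / Suc n) \<and> Y x \<in> ball e (1 / Suc n)}"
          by auto
        finally show "{x \<in> space M. X x \<in> ball d (1 / Suc n) \<and> Y x \<in> ball e (1 / Suc n)} \<in> sets M" .
      qed
      finally show "(\<lambda>x. (X x, Y x)) -` S \<inter> space M \<in> sets M" .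
    qed
  qed
qed

lemma random_var_const [simp]: "random_var M (\<lambda>x. a)"
  by (intro random_varI[of _ _ "{a}"]) (auto intro: closure_subset)

lemma random_var_diff:
  assumes "random_var M X" "random_var M Y"
  shows "random_var M (\<lambda>x. X x - Y x)"
  using random_var_compose[OF random_var_Pair[OF assms], of "\<lambda>p. fst p - snd p"]
  by (simp add: continuous_intros)

lemma random_var_add:
  assumes "random_var M X" "random_var M Y"
  shows "random_var M (\<lambda>x. X x + Y x)"
  using random_var_compose[OF random_var_Pair[OF assms], of "\<lambda>p. fst p + snd p"]
  by (simp add: continuous_intros)

lemma random_var_scaleR:
  assumes "random_var M X"
  shows "random_var M (\<lambda>x. a *\<^sub>R X x)"
  using random_var_compose[OF assms, of "\<lambda>p. a *\<^sub>R p"] by (simp add: continuous_intros)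

lemma random_var_norm:
  "random_var M X \<Longrightarrow> (\<lambda>x. norm (X x)) \<in> borel_measurable M"
  by (drule random_var_measurable) (auto intro!: borel_measurable_continuous_on continuous_intros)

lemma random_var_subalgebra:
  assumes "subalgebra M F" "random_var F X"
  shows "random_var M X"
  using assms measurable_from_subalg[OF assms(1)]
  by (auto simp: random_var_def subalgebra_def)

lemma integrable_norm_sq_bound:
  assumes "random_var M X" "integrable M f" "\<And>x. x \<in> space M \<Longrightarrow> (norm (X x))\<^sup>2 \<le> f x"
  shows "integrable M (\<lambda>x. (norm (X x))\<^sup>2)"
proof (rule Bochner_Integration.integrable_bound[OF assms(2)])
  show "(\<lambda>x. (norm (X x))\<^sup>2) \<in> borel_measurable M"
    using random_var_norm[OF assms(1)] by simp
  show "AE x in M. norm ((norm (X x))\<^sup>2) \<le> norm (f x)"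
    using assms(3) by (intro AE_I2) force
qed

lemma norm_sq_add_le: "(norm (a + b))\<^sup>2 \<le> 2 * (norm a)\<^sup>2 + 2 * (norm b)\<^sup>2"
  for a b :: "'h::real_normed_vector"
proof -
  have "(norm (a + b))\<^sup>2 \<le> (norm a + norm b)\<^sup>2"
    by (intro power_mono norm_triangle_ineq) auto
  also have "\<dots> \<le> 2 * (norm a)\<^sup>2 + 2 * (norm b)\<^sup>2"
    using zero_le_power2[of "norm a - norm b"] by (simp add: power2_sum power2_diff)
  finally show ?thesis .
qed

lemma integrable_norm_sq_add:
  assumes "random_var M X" "random_var M Y"
    and "integrable M (\<lambda>x. (norm (X x))\<^sup>2)" "integrable M (\<lambda>x. (norm (Y x))\<^sup>2)"
  shows "integrable M (\<lambda>x. (norm (X x + Y x))\<^sup>2)"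
  using assms
  by (intro integrable_norm_sq_bound[where f = "\<lambda>x. 2 * (norm (X x))\<^sup>2 + 2 * (norm (Y x))\<^sup>2"]
      random_var_add norm_sq_add_le) auto

lemma integrable_norm_sq_scaleR:
  assumes "integrable M (\<lambda>x. (norm (X x))\<^sup>2)"
  shows "integrable M (\<lambda>x. (norm (a *\<^sub>R X x))\<^sup>2)"
  using assms by (simp add: power_mult_distrib)

lemma integrable_norm_sq_diff:
  assumes "random_var M X" "random_var M Y"
    and "integrable M (\<lambda>x. (norm (X x))\<^sup>2)" "integrable M (\<lambda>x. (norm (Y x))\<^sup>2)"
  shows "integrable M (\<lambda>x. (norm (X x - Y x))\<^sup>2)"
  using integrable_norm_sq_add[of M X "\<lambda>x. (-1) *\<^sub>R Y x"]
    integrable_norm_sq_scaleR[of M Y "-1"] random_var_scaleR[of M Y "-1"] assms by simp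

lemma integrable_norm_mult_norm:
  assumes "random_var M X" "random_var M Y"
    and "integrable M (\<lambda>x. (norm (X x))\<^sup>2)" "integrable M (\<lambda>x. (norm (Y x))\<^sup>2)"
  shows "integrable M (\<lambda>x. norm (X x) * norm (Y x))"
proof (rule Bochner_Integration.integrable_bound)
  show "integrable M (\<lambda>x. (norm (X x))\<^sup>2 + (norm (Y x))\<^sup>2)"
    using assms by auto
  show "(\<lambda>x. norm (X x) * norm (Y x)) \<in> borel_measurable M"
    using assms by (auto intro!: borel_measurable_times random_var_norm)
  show "AE x in M. norm (norm (X x) * norm (Y x)) \<le> norm ((norm (X x))\<^sup>2 + (norm (Y x))\<^sup>2)"
  proof (intro AE_I2)
    fix x
    have "norm (X x) * norm (Y x) \<le> (norm (X x))\<^sup>2 + (norm (Y x))\<^sup>2"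
      using zero_le_power2[of "norm (X x) - norm (Y x)"] zero_le_power2[of "norm (X x)"]
        zero_le_power2[of "norm (Y x)"] unfolding power2_diff by linarith
    then show "norm (norm (X x) * norm (Y x)) \<le> norm ((norm (X x))\<^sup>2 + (norm (Y x))\<^sup>2)"
      by simp
  qed
qed

section \<open>Orthogonality of the conditional expectation\<close>

text \<open>
  This reduces the vector-valued integral to the real Bochner integral of the library. The bounded
  linear functional \<open>inner v\<close> maps an approximating sequence of simple functions to such a
  sequence.
\<close>

lemma has_vec_integral_inner:
  fixes X :: "'a \<Rightarrow> 'h::real_inner"
  assumes "has_vec_integral M X I"
  shows "has_bochner_integral M (\<lambda>x. inner v (X x)) (inner v I)"
proof -
  obtain s where X: "X \<in> borel_measurable M"
    and s: "\<And>i. Bochner_Integration.simple_bochner_integrable M (s i)"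
    and lim: "(\<lambda>i. \<integral>\<^sup>+x. ennreal (norm (X x - s i x)) \<partial>M) \<longlonglongrightarrow> 0"
    and int: "(\<lambda>i. Bochner_Integration.simple_bochner_integral M (s i)) \<longlonglongrightarrow> I"
    using assms by (auto simp: has_vec_integral_def random_var_def)
  have rX: "random_var M X"
    using assms by (simp add: has_vec_integral_def)
  have rs: "random_var M (s i)" for i
  proof -
    have sf: "simple_function M (s i)"
      using s[of i] by (auto elim: simple_bochner_integrable.cases)
    then show ?thesis
      by (intro random_varI[of _ _ "s i ` space M"] borel_measurable_simple_function)
        (auto intro: countable_finite simple_functionD closure_subset[THEN subsetD])
  qed
  show ?thesis
  proof (rule has_bochner_integral.intros[where s = "\<lambda>i x. inner v (s i x)"])
    show "(\<lambda>x. inner v (X x)) \<in> borel_measurable M"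
      using X by (rule borel_measurable_continuous_on[rotated]) (intro continuous_intros)
    show "Bochner_Integration.simple_bochner_integrable M (\<lambda>x. inner v (s i x))" for i
      using s[of i] by (intro simple_bochner_integrable_compose2[where p = "\<lambda>x y. inner v x"]) auto
    have "(\<lambda>i. Bochner_Integration.simple_bochner_integral M (\<lambda>x. inner v (s i x)))
        = (\<lambda>i. inner v (Bochner_Integration.simple_bochner_integral M (s i)))"
      using s by (intro ext simple_bochner_integral_linear)
        (auto intro: bounded_linear.linear bounded_linear_inner_right)
    then show "(\<lambda>i. Bochner_Integration.simple_bochner_integral M (\<lambda>x. inner v (s i x)))
        \<longlonglongrightarrow> inner v I"
      using int by (auto intro: tendsto_intros)
    show "(\<lambda>i. \<integral>\<^sup>+x. ennreal (norm (inner v (X x) - inner v (s i x))) \<partial>M) \<longlonglongrightarrow> 0"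
    proof (rule tendsto_sandwich[of "\<lambda>_. 0" _ _
          "\<lambda>i. ennreal (norm v) * (\<integral>\<^sup>+x. ennreal (norm (X x - s i x)) \<partial>M)"])
      show "eventually (\<lambda>i. (\<integral>\<^sup>+x. ennreal (norm (inner v (X x) - inner v (s i x))) \<partial>M)
          \<le> ennreal (norm v) * (\<integral>\<^sup>+x. ennreal (norm (X x - s i x)) \<partial>M)) sequentially"
      proof (intro always_eventually allI)
        fix i
        have "(\<integral>\<^sup>+x. ennreal (norm (inner v (X x) - inner v (s i x))) \<partial>M)
            \<le> (\<integral>\<^sup>+x. ennreal (norm v) * ennreal (norm (X x - s i x)) \<partial>M)"
          by (intro nn_integral_mono)
            (auto simp: Cauchy_Schwarz_ineq2 simp flip: inner_diff_right ennreal_mult)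
        also have "\<dots> = ennreal (norm v) * (\<integral>\<^sup>+x. ennreal (norm (X x - s i x)) \<partial>M)"
          using random_var_norm[OF random_var_diff[OF rX rs[of i]]]
          by (intro nn_integral_cmult) simp
        finally show "(\<integral>\<^sup>+x. ennreal (norm (inner v (X x) - inner v (s i x))) \<partial>M) \<le> \<dots>" .
      qed
      show "(\<lambda>i. ennreal (norm v) * (\<integral>\<^sup>+x. ennreal (norm (X x - s i x)) \<partial>M)) \<longlonglongrightarrow> 0"
        using ennreal_tendsto_cmult[OF _ lim, of "ennreal (norm v)"] by simp
    qed auto
  qed
qed

lemma cond_exp_diff_inner_const:
  fixes X :: "'a \<Rightarrow> 'h::real_inner"
  assumes "has_cond_exp M F X Y" "S \<in> sets F"
  shows "has_bochner_integral M (\<lambda>x. indicator S x * inner v (X x - Y x)) 0"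
proof -
  obtain I where I: "has_vec_integral M (\<lambda>x. indicator S x *\<^sub>R X x) I"
    "has_vec_integral M (\<lambda>x. indicator S x *\<^sub>R Y x) I"
    using assms by (auto simp: has_cond_exp_def)
  then have "has_bochner_integral M
      (\<lambda>x. inner v (indicator S x *\<^sub>R X x) - inner v (indicator S x *\<^sub>R Y x)) (inner v I - inner v I)"
    by (intro has_bochner_integral_diff has_vec_integral_inner)
  then show ?thesis
    by (simp add: inner_diff_right right_diff_distrib)
qed

text \<open>
  The best approximation of \<open>v\<close> among \<open>0, d 0, \<dots>, d (k - 1)\<close>. Starting from \<open>0\<close> keeps the error below
  \<open>norm v\<close>, and the recursion changes the value on a single event at each stage.
\<close>

primrec nearest :: "(nat \<Rightarrow> 'h::real_normed_vector) \<Rightarrow> nat \<Rightarrow> 'h \<Rightarrow> 'h" where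
  "nearest d 0 v = 0"
| "nearest d (Suc k) v = (if norm (d k - v) < norm (nearest d k v - v) then d k else nearest d k v)"

lemma norm_nearest_Suc:
  "norm (nearest d (Suc k) v - v) = min (norm (d k - v)) (norm (nearest d k v - v))"
  by auto

lemma norm_nearest_diff_le: "norm (nearest d k v - v) \<le> norm v"
  by (induction k) auto

lemma norm_nearest_le: "norm (nearest d k v) \<le> 2 * norm v"
  using norm_triangle_ineq[of "nearest d k v - v" v] norm_nearest_diff_le[of d k v] by simp

lemma nearest_tendsto:
  assumes "v \<in> closure (range d)"
  shows "(\<lambda>k. nearest d k v) \<longlonglongrightarrow> v"
proof (rule LIMSEQ_I)
  fix e :: real assume "0 < e"
  then obtain j where j: "norm (d j - v) < e"
    using assms closure_approachable[of v "range d"] by (auto simp: dist_norm)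
  have "norm (nearest d k v - v) < e" if "Suc j \<le> k" for k
    using that
  proof (induction k rule: dec_induct)
    case base
    then show ?case using j by (simp add: norm_nearest_Suc del: nearest.simps)
  next
    case (step k)
    then show ?case by (simp add: norm_nearest_Suc del: nearest.simps)
  qed
  then show "\<exists>N. \<forall>k\<ge>N. norm (nearest d k v - v) < e"
    by blast
qed

text \<open>
  Orthogonality to simple \<open>F\<close>-measurable test functions. Quantifying over all test sets \<open>S\<close> makes
  the induction work: passing from \<open>k\<close> to \<open>Suc k\<close> splits \<open>S\<close> into the \<open>F\<close>-measurable event where
  the new point is closer and its complement.
\<close>

lemma cond_exp_diff_inner_nearest:
  fixes X :: "'a \<Rightarrow> 'h::real_inner"
  assumes "has_cond_exp M F X Y" and V: "V \<in> borel_measurable F" and "S \<in> sets F"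
  shows "has_bochner_integral M (\<lambda>x. indicator S x * inner (nearest d k (V x)) (X x - Y x)) 0"
  using \<open>S \<in> sets F\<close>
proof (induction k arbitrary: S)
  case (Suc k)
  have cont: "(\<lambda>x. norm (a - V x)) \<in> borel_measurable F" for a
    by (rule borel_measurable_continuous_on[OF _ V]) (intro continuous_intros)
  have gap [measurable]: "(\<lambda>x. norm (nearest d j (V x) - V x)) \<in> borel_measurable F" for j
  proof (induction j)
    case 0
    then show ?case using cont[of 0] by simp
  next
    case (Suc j)
    then show ?case using cont[of "d j"] unfolding norm_nearest_Suc by measurable
  qed
  define T where "T = {x \<in> space F. norm (d k - V x) < norm (nearest d k (V x) - V x)}"
  have "T \<in> sets F"
    unfolding T_def using cont[of "d k"] by measurable
  then have sets: "S \<inter> T \<in> sets F" "S - T \<in> sets F"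
    using Suc.prems by auto
  have "has_bochner_integral M
      (\<lambda>x. indicator (S \<inter> T) x * inner (d k) (X x - Y x)
        + indicator (S - T) x * inner (nearest d k (V x)) (X x - Y x)) (0 + 0)"
    using sets Suc.IH assms by (intro has_bochner_integral_add cond_exp_diff_inner_const)
  moreover have "indicator S x * inner (nearest d (Suc k) (V x)) (X x - Y x)
      = indicator (S \<inter> T) x * inner (d k) (X x - Y x)
        + indicator (S - T) x * inner (nearest d k (V x)) (X x - Y x)" for x
    using sets.sets_into_space[OF Suc.prems] by (auto simp: indicator_def T_def)
  ultimately show ?case
    by simp
qed auto

text \<open>
  The nearest-point
  approximations of \<open>V\<close> converge pointwise and are dominated by \<open>2 * norm V\<close>, so dominated
  convergence carries orthogonality to \<open>X - Y\<close> over from them to \<open>V\<close>.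
\<close>

lemma cond_exp_diff_orthogonal:
  fixes X :: "'a \<Rightarrow> 'h::real_inner"
  assumes sub: "subalgebra M F" and ce: "has_cond_exp M F X Y" and V: "random_var F V"
    and int: "integrable M (\<lambda>x. norm (V x) * norm (X x - Y x))"
  shows "integrable M (\<lambda>x. inner (V x) (X x - Y x))" "(\<integral>x. inner (V x) (X x - Y x) \<partial>M) = 0"
proof -
  have space: "space M = space F"
    using sub by (simp add: subalgebra_def)
  obtain D where D: "countable D" "V ` space F \<subseteq> closure D"
    using V by (rule random_var_dense)
  \<comment> \<open>The set \<open>D\<close> may be empty, and enumerating needs a nonempty set.\<close>
  define d where "d = from_nat_into (insert 0 D)"
  have "range d = insert 0 D"
    using D by (auto simp: d_def range_from_nat_into)
  then have dense: "V x \<in> closure (range d)" if "x \<in> space M" for x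
    using D that space closure_mono[of D "insert 0 D"] by auto
  let ?g = "\<lambda>k x. inner (nearest d k (V x)) (X x - Y x)"
  have g: "has_bochner_integral M (?g k) 0" for k
  proof -
    have "has_bochner_integral M (\<lambda>x. indicator (space F) x * ?g k x) 0"
      using ce V by (intro cond_exp_diff_inner_nearest) (auto dest: random_var_measurable)
    then show ?thesis
      by (subst has_bochner_integral_cong[OF refl _ refl]) (auto simp: space)
  qed
  have lim: "(\<lambda>k. ?g k x) \<longlonglongrightarrow> inner (V x) (X x - Y x)" if "x \<in> space M" for x
    using that dense by (intro tendsto_intros nearest_tendsto)
  have meas: "(\<lambda>x. inner (V x) (X x - Y x)) \<in> borel_measurable M"
    by (rule borel_measurable_LIMSEQ_real[OF lim]) (use g in \<open>auto dest: borel_measurable_has_bochner_integral\<close>)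
  have bound: "norm (?g k x) \<le> 2 * (norm (V x) * norm (X x - Y x))" for k x
  proof -
    have "norm (?g k x) \<le> norm (nearest d k (V x)) * norm (X x - Y x)"
      by (simp add: Cauchy_Schwarz_ineq2)
    also have "\<dots> \<le> 2 * norm (V x) * norm (X x - Y x)"
      by (intro mult_right_mono norm_nearest_le) auto
    finally show ?thesis by simp
  qed
  have dom: "integrable M (\<lambda>x. 2 * (norm (V x) * norm (X x - Y x)))"
    using int by simp
  show "integrable M (\<lambda>x. inner (V x) (X x - Y x))"
    using g lim bound
    by (intro integrable_dominated_convergence[OF meas _ dom, of ?g])
      (auto dest: borel_measurable_has_bochner_integral)
  have "(\<lambda>k. \<integral>x. ?g k x \<partial>M) \<longlonglongrightarrow> (\<integral>x. inner (V x) (X x - Y x) \<partial>M)"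
    using g lim bound
    by (intro integral_dominated_convergence[OF meas _ dom]) (auto dest: borel_measurable_has_bochner_integral)
  then show "(\<integral>x. inner (V x) (X x - Y x) \<partial>M) = 0"
    using g[THEN has_bochner_integral_integral_eq] by (simp add: LIMSEQ_const_iff)
qed

lemma gen_sigma_subalgebra:
  assumes "\<And>i. 1 \<le> i \<Longrightarrow> i \<le> n \<Longrightarrow> w i \<in> borel_measurable M"
  shows "subalgebra M (gen_sigma M w n)"
proof -
  let ?G = "{w i -` S \<inter> space M | i S. i \<in> {1..n} \<and> S \<in> sets borel}"
  have "?G \<subseteq> Pow (space M)" by auto
  moreover have "sigma_sets (space M) ?G \<subseteq> sets M"
    using assms by (intro sets.sigma_sets_subset) (auto intro: measurable_sets)
  ultimately show ?thesis
    by (simp add: subalgebra_def gen_sigma_def)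
qed

lemma random_var_gen_sigma:
  assumes "random_var M (w n)" "1 \<le> n"
  shows "random_var (gen_sigma M w n) (w n)"
proof -
  let ?G = "{w i -` S \<inter> space M | i S. i \<in> {1..n} \<and> S \<in> sets borel}"
  have G: "?G \<subseteq> Pow (space M)" by auto
  then have space: "space (gen_sigma M w n) = space M" and sets: "sets (gen_sigma M w n) = sigma_sets (space M) ?G"
    by (auto simp: gen_sigma_def)
  have "w n \<in> borel_measurable (gen_sigma M w n)"
    using assms by (intro measurableI) (auto simp: space sets intro!: sigma_sets.Basic)
  then show ?thesis
    using assms by (simp add: random_var_def space)
qed

section \<open>One forward-backward step\<close>

lemma strongly_monotone_opD:
  assumes "strongly_monotone_op \<nu> A" "u \<in> A w" "v \<in> A y"
  shows "\<nu> * (norm (w - y))\<^sup>2 \<le> inner (w - y) (u - v)"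
proof -
  have "0 \<le> inner (w - y) ((u - \<nu> *\<^sub>R w) - (v - \<nu> *\<^sub>R y))"
    using assms unfolding strongly_monotone_op_def monotone_op_def graph_of_def by blast
  also have "(u - \<nu> *\<^sub>R w) - (v - \<nu> *\<^sub>R y) = (u - v) - \<nu> *\<^sub>R (w - y)"
    by (simp add: algebra_simps)
  finally show ?thesis
    by (simp add: inner_diff_right[of "w - y" "u - v"] power2_norm_eq_inner)
qed

text \<open>
  Strong monotonicity bounds \<open>inner (y - y') (z - z')\<close> from below by
  \<open>(1 + \<gamma> * \<nu>) * (norm (y - y'))\<^sup>2\<close>. In particular the resolvent is single-valued and continuous on its
  domain.
\<close>

lemma resolvent_contraction:
  assumes A: "strongly_monotone_op \<nu> A" and "0 \<le> \<nu>" "0 \<le> \<gamma>"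
    and y: "y \<in> resolvent \<gamma> A z" "y' \<in> resolvent \<gamma> A z'"
  shows "(1 + \<gamma> * \<nu>) * norm (y - y') \<le> norm (z - z')"
proof -
  obtain u u' where u: "u \<in> A y" "z = y + \<gamma> *\<^sub>R u" "u' \<in> A y'" "z' = y' + \<gamma> *\<^sub>R u'"
    using y by (auto simp: resolvent_def)
  have "(1 + \<gamma> * \<nu>) * (norm (y - y'))\<^sup>2 = inner (y - y') (y - y') + \<gamma> * (\<nu> * (norm (y - y'))\<^sup>2)"
    by (simp add: power2_norm_eq_inner algebra_simps)
  also have "\<dots> \<le> inner (y - y') (y - y') + \<gamma> * inner (y - y') (u - u')"
    using u strongly_monotone_opD[OF A] \<open>0 \<le> \<gamma>\<close> by (intro add_left_mono mult_left_mono) auto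
  also have "\<dots> = inner (y - y') (z - z')"
    using u by (simp add: inner_diff_right inner_add_right algebra_simps)
  also have "\<dots> \<le> norm (y - y') * norm (z - z')"
    by (rule norm_cauchy_schwarz)
  finally have "((1 + \<gamma> * \<nu>) * norm (y - y')) * norm (y - y') \<le> norm (z - z') * norm (y - y')"
    by (simp add: power2_eq_square algebra_simps)
  then have "(1 + \<gamma> * \<nu>) * norm (y - y') \<le> norm (z - z')" if "y \<noteq> y'"
    by (rule mult_right_le_imp_le) (use that in simp)
  then show ?thesis
    by (cases "y = y'") auto
qed

lemma zero_is_fixed_point:
  assumes "v \<in> zer_sum A B"
  shows "v \<in> resolvent \<gamma> A (v - \<gamma> *\<^sub>R B v)"
proof -
  obtain u where "u \<in> A v" "u + B v = 0"
    using assms by (auto simp: zer_sum_def)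
  then have "- B v \<in> A v"
    by (metis add_eq_0_iff2)
  then show ?thesis
    by (auto simp: resolvent_def intro!: image_eqI[of _ _ "- B v"])
qed

text \<open>
  On the range of \<open>Z\<close> a selection of the resolvent is 1-Lipschitz, hence continuous, and \<open>Y\<close> is its
  composition with \<open>Z\<close>.
\<close>

lemma random_var_resolvent:
  assumes A: "strongly_monotone_op \<nu> A" "0 \<le> \<nu>" "0 \<le> \<gamma>" and Z: "random_var M Z"
    and Y: "\<And>x. x \<in> space M \<Longrightarrow> Y x \<in> resolvent \<gamma> A (Z x)"
  shows "random_var M Y"
proof -
  have close: "norm (y - y') \<le> norm (z - z')"
    if "y \<in> resolvent \<gamma> A z" "y' \<in> resolvent \<gamma> A z'" for y y' z z'
  proof -
    have "1 * norm (y - y') \<le> (1 + \<gamma> * \<nu>) * norm (y - y')"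
      using A by (intro mult_right_mono) auto
    with resolvent_contraction[OF A that] show ?thesis by simp
  qed
  define J where "J z = (SOME y. y \<in> resolvent \<gamma> A z)" for z
  have J: "J z \<in> resolvent \<gamma> A z" if "z \<in> Z ` space M" for z
    unfolding J_def using that Y by (metis image_iff someI_ex)
  have "continuous_on (Z ` space M) J"
    unfolding continuous_on_iff
  proof (intro ballI allI impI)
    fix z and e :: real assume "z \<in> Z ` space M" "0 < e"
    then show "\<exists>d>0. \<forall>z'\<in>Z ` space M. dist z' z < d \<longrightarrow> dist (J z') (J z) < e"
      using close J unfolding dist_norm by (intro exI[of _ e]) (meson le_less_trans)
  qed
  then have "random_var M (\<lambda>x. J (Z x))"
    using Z by (rule random_var_compose[rotated])
  moreover have "J (Z x) = Y x" if "x \<in> space M" for x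
    using close[OF J Y, of "Z x" x] that by simp
  ultimately show ?thesis
    by (rule random_var_cong)
qed

lemma cocoercive_lipschitz:
  assumes "cocoercive \<beta> B" "0 < \<beta>"
  shows "norm (B w - B y) \<le> norm (w - y) / \<beta>"
proof -
  have "(norm (B w - B y) * \<beta>) * norm (B w - B y) = \<beta> * (norm (B w - B y))\<^sup>2"
    by (simp add: power2_eq_square)
  also have "\<dots> \<le> inner (w - y) (B w - B y)"
    using assms by (simp add: cocoercive_def)
  also have "\<dots> \<le> norm (w - y) * norm (B w - B y)"
    by (rule norm_cauchy_schwarz)
  finally have "norm (B w - B y) * \<beta> \<le> norm (w - y)" if "B w \<noteq> B y"
    by (rule mult_right_le_imp_le) (use that in simp)
  then have "norm (B w - B y) * \<beta> \<le> norm (w - y)"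
    by (cases "B w = B y") auto
  then show ?thesis
    using assms by (simp add: pos_le_divide_eq)
qed

lemma cocoercive_continuous:
  assumes "cocoercive \<beta> B" "0 < \<beta>"
  shows "continuous_on S B"
  unfolding continuous_on_iff
proof (intro ballI allI impI)
  fix y and e :: real assume "0 < e"
  have "dist (B w) (B y) < e" if "dist w y < e * \<beta>" for w
    using cocoercive_lipschitz[OF assms, of w y] that assms
    by (simp add: dist_norm pos_divide_less_eq[symmetric])
  then show "\<exists>d>0. \<forall>w\<in>S. dist w y < d \<longrightarrow> dist (B w) (B y) < e"
    using \<open>0 < e\<close> assms by (intro exI[of _ "e * \<beta>"]) auto
qed

lemma norm_sq_diff_scaleR:
  fixes a b :: "'h::real_inner"
  shows "(norm (a - \<gamma> *\<^sub>R b))\<^sup>2 = (norm a)\<^sup>2 - 2 * \<gamma> * inner a b + \<gamma>\<^sup>2 * (norm b)\<^sup>2"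
  unfolding power2_norm_eq_inner
  by (simp add: inner_diff_left inner_diff_right inner_commute[of b a] power2_eq_square algebra_simps)

text \<open>
  Expanding the square leaves the cross term \<open>- 2 * \<gamma> * inner (w - v) (B w - B v)\<close>. By the step size
  condition and cocoercivity, the fraction \<open>2 - \<epsilon>\<close> of it absorbs all multiples of
  \<open>(norm (B w - B v))\<^sup>2\<close>, including those that come from the state-dependent part of the variance via
  \<open>(norm (B w))\<^sup>2 \<le> 2 * (norm (B w - B v))\<^sup>2 + 2 * (norm (B v))\<^sup>2\<close>. The remaining fraction \<open>\<epsilon>\<close>
  gives the contraction, through strong monotonicity of \<open>B\<close> at \<open>v\<close>.
\<close>

lemma forward_step_bound:
  fixes B :: "'h::real_inner \<Rightarrow> 'h"
  assumes B: "cocoercive \<beta> B" "strongly_monotone_at \<mu> B v"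
    and "0 < \<beta>" "0 \<le> \<epsilon>" "0 < \<gamma>" "0 \<le> \<alpha>" and \<gamma>: "\<gamma> \<le> (2 - \<epsilon>) * \<beta> / (1 + 2 * \<sigma>\<^sup>2 * \<alpha>)"
  shows "(norm ((w - v) - \<gamma> *\<^sub>R (B w - B v)))\<^sup>2 + \<gamma>\<^sup>2 * (\<sigma>\<^sup>2 * (1 + \<alpha> * (norm (B w))\<^sup>2))
    \<le> (1 - \<epsilon> * \<mu> * \<gamma>) * (norm (w - v))\<^sup>2 + 2 * \<gamma>\<^sup>2 * \<sigma>\<^sup>2 * (1 + \<alpha> * (norm (B v))\<^sup>2)"
proof -
  define a where "a = (norm (B w - B v))\<^sup>2"
  define b where "b = (norm (B v))\<^sup>2"
  define p where "p = inner (w - v) (B w - B v)"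
  define d where "d = (norm (w - v))\<^sup>2"
  have "0 < 1 + 2 * \<sigma>\<^sup>2 * \<alpha>"
    using \<open>0 \<le> \<alpha>\<close> by (simp add: add_pos_nonneg)
  then have "\<gamma> * (1 + 2 * \<sigma>\<^sup>2 * \<alpha>) \<le> (2 - \<epsilon>) * \<beta>"
    using \<gamma> by (simp add: pos_le_divide_eq)
  then have "\<gamma> * (1 + 2 * \<sigma>\<^sup>2 * \<alpha>) * (\<gamma> * a) \<le> (2 - \<epsilon>) * \<beta> * (\<gamma> * a)"
    using \<open>0 < \<gamma>\<close> by (intro mult_right_mono) (auto simp: a_def)
  moreover have "0 < (2 - \<epsilon>)"
  proof -
    have "0 < (2 - \<epsilon>) * \<beta>"
      using \<open>0 < \<gamma>\<close> \<open>0 < 1 + 2 * \<sigma>\<^sup>2 * \<alpha>\<close> \<open>\<gamma> * (1 + 2 * \<sigma>\<^sup>2 * \<alpha>) \<le> (2 - \<epsilon>) * \<beta>\<close>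
      by (meson less_le_trans mult_pos_pos)
    then show ?thesis using \<open>0 < \<beta>\<close> by (simp add: zero_less_mult_iff)
  qed
  moreover have "\<beta> * a \<le> p"
    using B by (simp add: cocoercive_def a_def p_def)
  ultimately have "\<gamma> * (1 + 2 * \<sigma>\<^sup>2 * \<alpha>) * (\<gamma> * a) \<le> (2 - \<epsilon>) * \<beta> * (\<gamma> * a)"
    "(2 - \<epsilon>) * \<gamma> * (\<beta> * a) \<le> (2 - \<epsilon>) * \<gamma> * p"
    using \<open>0 < \<gamma>\<close> by (auto intro!: mult_left_mono)
  moreover have "\<gamma> * (1 + 2 * \<sigma>\<^sup>2 * \<alpha>) * (\<gamma> * a) = \<gamma>\<^sup>2 * (1 + 2 * \<sigma>\<^sup>2 * \<alpha>) * a"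
    "(2 - \<epsilon>) * \<beta> * (\<gamma> * a) = (2 - \<epsilon>) * \<gamma> * (\<beta> * a)"
    by (simp_all add: power2_eq_square)
  ultimately have 1: "\<gamma>\<^sup>2 * (1 + 2 * \<sigma>\<^sup>2 * \<alpha>) * a \<le> (2 - \<epsilon>) * \<gamma> * p"
    by linarith
  have "(norm (B w))\<^sup>2 \<le> 2 * a + 2 * b"
    using norm_sq_add_le[of "B w - B v" "B v"] by (simp add: a_def b_def)
  then have 2: "\<gamma>\<^sup>2 * (\<sigma>\<^sup>2 * (1 + \<alpha> * (norm (B w))\<^sup>2)) \<le> \<gamma>\<^sup>2 * (\<sigma>\<^sup>2 * (1 + \<alpha> * (2 * a + 2 * b)))"
    using \<open>0 \<le> \<alpha>\<close> by (intro mult_left_mono add_left_mono) auto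
  have 3: "\<epsilon> * \<gamma> * (\<mu> * d) \<le> \<epsilon> * \<gamma> * p"
    using B \<open>0 \<le> \<epsilon>\<close> \<open>0 < \<gamma>\<close>
    by (intro mult_left_mono) (auto simp: strongly_monotone_at_def d_def p_def)
  have "(norm ((w - v) - \<gamma> *\<^sub>R (B w - B v)))\<^sup>2 = d - 2 * \<gamma> * p + \<gamma>\<^sup>2 * a"
    unfolding d_def p_def a_def by (rule norm_sq_diff_scaleR)
  then have "(norm ((w - v) - \<gamma> *\<^sub>R (B w - B v)))\<^sup>2 + \<gamma>\<^sup>2 * (\<sigma>\<^sup>2 * (1 + \<alpha> * (norm (B w))\<^sup>2))
      \<le> d - 2 * \<gamma> * p + \<gamma>\<^sup>2 * (1 + 2 * \<sigma>\<^sup>2 * \<alpha>) * a + \<gamma>\<^sup>2 * \<sigma>\<^sup>2 * (1 + 2 * \<alpha> * b)"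
    using 2 by (simp add: algebra_simps)
  also have "\<dots> \<le> d - \<epsilon> * \<gamma> * p + \<gamma>\<^sup>2 * \<sigma>\<^sup>2 * (1 + 2 * \<alpha> * b)"
    using 1 by (simp add: algebra_simps)
  also have "\<dots> \<le> d - \<epsilon> * \<gamma> * (\<mu> * d) + \<gamma>\<^sup>2 * \<sigma>\<^sup>2 * (2 + 2 * \<alpha> * b)"
  proof -
    have "\<gamma>\<^sup>2 * \<sigma>\<^sup>2 * (1 + 2 * \<alpha> * b) \<le> \<gamma>\<^sup>2 * \<sigma>\<^sup>2 * (2 + 2 * \<alpha> * b)"
      by (intro mult_left_mono) auto
    with 3 show ?thesis by linarith
  qed
  finally show ?thesis
    by (simp add: d_def b_def algebra_simps)
qed

lemma norm_sq_convex:
  fixes a b :: "'h::real_inner"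
  assumes "0 \<le> l" "l \<le> 1"
  shows "(norm ((1 - l) *\<^sub>R a + l *\<^sub>R b))\<^sup>2 \<le> (1 - l) * (norm a)\<^sup>2 + l * (norm b)\<^sup>2"
proof -
  have "(1 - l) * (norm a)\<^sup>2 + l * (norm b)\<^sup>2 - (norm ((1 - l) *\<^sub>R a + l *\<^sub>R b))\<^sup>2
      = l * (1 - l) * (norm (a - b))\<^sup>2"
    unfolding power2_norm_eq_inner
    by (simp add: inner_add_left inner_add_right inner_diff_left inner_diff_right inner_commute[of b a])
      (simp add: algebra_simps)
  also have "0 \<le> \<dots>"
    using assms by simp
  finally show ?thesis by simp
qed

text \<open>
  With \<open>V = (W - v) - \<gamma> (B W - B v)\<close> and the noise \<open>N = X - B W\<close>, the forward displacement is
  \<open>V - \<gamma> N\<close>. The vector \<open>V\<close> is a function of \<open>W\<close>, hence \<open>F\<close>-measurable, so it is orthogonal to \<open>N\<close>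
  and the second moments add up; the variance bound and \<open>forward_step_bound\<close> then apply. The
  backward step contracts by \<open>1 / (1 + \<gamma> * \<nu>)\<close>, since \<open>v\<close> is the resolvent of \<open>v - \<gamma> B v\<close>, and the
  relaxation is handled by convexity.
\<close>

lemma stochastic_forward_backward_step:
  fixes A :: "'h::real_inner \<Rightarrow> 'h set"
  assumes "prob_space M" and sub: "subalgebra M F"
    and A: "strongly_monotone_op \<nu> A" "0 \<le> \<nu>"
    and B: "cocoercive \<beta> B" "0 < \<beta>" "strongly_monotone_at \<mu> B v"
    and v: "v \<in> zer_sum A B"
    and W: "random_var F W" "integrable M (\<lambda>x. (norm (W x))\<^sup>2)"
    and X: "random_var M X" "integrable M (\<lambda>x. (norm (X x))\<^sup>2)"
    and mean: "has_cond_exp M F X (\<lambda>x. B (W x))"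
    and var: "AE x in M. real_cond_exp M F (\<lambda>x. (norm (X x - B (W x)))\<^sup>2) x
        \<le> \<sigma>\<^sup>2 * (1 + \<alpha> * (norm (B (W x)))\<^sup>2)"
    and "0 \<le> \<epsilon>" "0 < \<gamma>" "0 \<le> \<alpha>" and \<gamma>: "\<gamma> \<le> (2 - \<epsilon>) * \<beta> / (1 + 2 * \<sigma>\<^sup>2 * \<alpha>)"
    and l: "0 \<le> l" "l \<le> 1"
    and Y: "\<And>x. x \<in> space M \<Longrightarrow> Y x \<in> resolvent \<gamma> A (W x - \<gamma> *\<^sub>R X x)"
    and W': "\<And>x. x \<in> space M \<Longrightarrow> W' x = (1 - l) *\<^sub>R W x + l *\<^sub>R Y x"
  shows "random_var M W'" "integrable M (\<lambda>x. (norm (W' x))\<^sup>2)"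
    "(\<integral>x. (norm (W' x - v))\<^sup>2 \<partial>M) \<le> (1 - l) * (\<integral>x. (norm (W x - v))\<^sup>2 \<partial>M)
      + l / (1 + \<gamma> * \<nu>)\<^sup>2 * ((1 - \<epsilon> * \<mu> * \<gamma>) * (\<integral>x. (norm (W x - v))\<^sup>2 \<partial>M)
        + 2 * \<gamma>\<^sup>2 * \<sigma>\<^sup>2 * (1 + \<alpha> * (norm (B v))\<^sup>2))"
proof -
  interpret prob_space M by fact
  interpret finite_measure_subalgebra M F
    using sub by unfold_locales
  have const: "random_var M (\<lambda>x. a)" "integrable M (\<lambda>x. (norm a)\<^sup>2)" for a :: 'h
    by auto
  note sq = integrable_norm_sq_add integrable_norm_sq_diff integrable_norm_sq_scaleR
    random_var_add random_var_diff random_var_scaleR const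
  have rW: "random_var M W"
    using sub W(1) by (rule random_var_subalgebra)
  have BW_F: "random_var F (\<lambda>x. B (W x))"
    using W(1) cocoercive_continuous[OF B(1,2)] by (rule random_var_compose)
  have BW: "random_var M (\<lambda>x. B (W x))"
    using sub BW_F by (rule random_var_subalgebra)
  have "integrable M (\<lambda>x. (norm (B (W x) - B v))\<^sup>2)"
  proof (rule integrable_norm_sq_bound)
    show "integrable M (\<lambda>x. (norm (W x - v))\<^sup>2 * (1 / \<beta>)\<^sup>2)"
      using rW W by (intro integrable_mult_left sq)
    show "(norm (B (W x) - B v))\<^sup>2 \<le> (norm (W x - v))\<^sup>2 * (1 / \<beta>)\<^sup>2" for x
      using power_mono[OF cocoercive_lipschitz[OF B(1,2), of "W x" v], of 2]
      by (simp add: power_divide power_mult_distrib)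
  qed (use BW in \<open>intro sq\<close>)
  from integrable_norm_sq_add[OF random_var_diff[OF BW const(1)] const(1) this const(2), of "B v"]
  have iBW: "integrable M (\<lambda>x. (norm (B (W x)))\<^sup>2)"
    by simp
  define V where "V x = (W x - v) - \<gamma> *\<^sub>R (B (W x) - B v)" for x
  define N where "N x = X x - B (W x)" for x
  have V_F: "random_var F V"
    unfolding V_def using W(1) BW_F by (intro random_var_diff random_var_scaleR random_var_const)
  have V: "random_var M V" "integrable M (\<lambda>x. (norm (V x))\<^sup>2)"
    unfolding V_def by (intro sq rW W BW iBW)+
  have N: "random_var M N" "integrable M (\<lambda>x. (norm (N x))\<^sup>2)"
    unfolding N_def by (intro sq X BW iBW)+
  have "integrable M (\<lambda>x. norm (V x) * norm (N x))"
    using V N by (intro integrable_norm_mult_norm)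
  then have cross: "integrable M (\<lambda>x. inner (V x) (N x))" "(\<integral>x. inner (V x) (N x) \<partial>M) = 0"
    unfolding N_def using cond_exp_diff_orthogonal[OF sub mean V_F] by auto
  have "(\<integral>x. (norm (N x))\<^sup>2 \<partial>M) = (\<integral>x. real_cond_exp M F (\<lambda>x. (norm (N x))\<^sup>2) x \<partial>M)"
    using real_cond_exp_int(2)[OF N(2)] by simp
  also have "\<dots> \<le> (\<integral>x. \<sigma>\<^sup>2 * (1 + \<alpha> * (norm (B (W x)))\<^sup>2) \<partial>M)"
    using N var iBW real_cond_exp_int(1)[OF N(2)] unfolding N_def
    by (intro integral_mono_AE) auto
  finally have noise: "(\<integral>x. (norm (N x))\<^sup>2 \<partial>M) \<le> (\<integral>x. \<sigma>\<^sup>2 * (1 + \<alpha> * (norm (B (W x)))\<^sup>2) \<partial>M)" .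
  have VN: "(norm (V x - \<gamma> *\<^sub>R N x))\<^sup>2 = (norm (V x))\<^sup>2 - 2 * \<gamma> * inner (V x) (N x) + \<gamma>\<^sup>2 * (norm (N x))\<^sup>2" for x
    by (rule norm_sq_diff_scaleR)
  define S where "S = (\<integral>x. (norm (W x - v))\<^sup>2 \<partial>M)"
  have iW: "integrable M (\<lambda>x. (norm (W x - v))\<^sup>2)"
    using rW W by (intro sq)
  have "(\<integral>x. (norm (V x - \<gamma> *\<^sub>R N x))\<^sup>2 \<partial>M) = (\<integral>x. (norm (V x))\<^sup>2 \<partial>M) + \<gamma>\<^sup>2 * (\<integral>x. (norm (N x))\<^sup>2 \<partial>M)"
    unfolding VN using V N cross by simp
  also have "\<dots> \<le> (\<integral>x. (norm (V x))\<^sup>2 \<partial>M) + \<gamma>\<^sup>2 * (\<integral>x. \<sigma>\<^sup>2 * (1 + \<alpha> * (norm (B (W x)))\<^sup>2) \<partial>M)"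
    using noise by (intro add_left_mono mult_left_mono) auto
  also have "\<dots> = (\<integral>x. (norm (V x))\<^sup>2 + \<gamma>\<^sup>2 * (\<sigma>\<^sup>2 * (1 + \<alpha> * (norm (B (W x)))\<^sup>2)) \<partial>M)"
    using V iBW by (subst Bochner_Integration.integral_add) auto
  also have "\<dots> \<le> (\<integral>x. (1 - \<epsilon> * \<mu> * \<gamma>) * (norm (W x - v))\<^sup>2 + 2 * \<gamma>\<^sup>2 * \<sigma>\<^sup>2 * (1 + \<alpha> * (norm (B v))\<^sup>2) \<partial>M)"
    using V iBW iW forward_step_bound[OF B(1,3,2) \<open>0 \<le> \<epsilon>\<close> \<open>0 < \<gamma>\<close> \<open>0 \<le> \<alpha>\<close> \<gamma>]
    unfolding V_def by (intro integral_mono) auto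
  also have "\<dots> = (1 - \<epsilon> * \<mu> * \<gamma>) * S + 2 * \<gamma>\<^sup>2 * \<sigma>\<^sup>2 * (1 + \<alpha> * (norm (B v))\<^sup>2)"
    using iW by (simp add: S_def prob_space)
  finally have forward: "(\<integral>x. (norm (V x - \<gamma> *\<^sub>R N x))\<^sup>2 \<partial>M) \<le> \<dots>" .
  have pos: "0 < 1 + \<gamma> * \<nu>"
    using A \<open>0 < \<gamma>\<close> by (simp add: add_pos_nonneg)
  have backward: "(norm (Y x - v))\<^sup>2 \<le> (norm (V x - \<gamma> *\<^sub>R N x))\<^sup>2 / (1 + \<gamma> * \<nu>)\<^sup>2" if "x \<in> space M" for x
  proof -
    have "(1 + \<gamma> * \<nu>) * norm (Y x - v) \<le> norm ((W x - \<gamma> *\<^sub>R X x) - (v - \<gamma> *\<^sub>R B v))"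
      using A \<open>0 < \<gamma>\<close> Y[OF that] zero_is_fixed_point[OF v] by (intro resolvent_contraction) auto
    also have "(W x - \<gamma> *\<^sub>R X x) - (v - \<gamma> *\<^sub>R B v) = V x - \<gamma> *\<^sub>R N x"
      by (simp add: V_def N_def algebra_simps)
    finally have "((1 + \<gamma> * \<nu>) * norm (Y x - v))\<^sup>2 \<le> (norm (V x - \<gamma> *\<^sub>R N x))\<^sup>2"
      using pos by (intro power_mono) auto
    then show ?thesis
      using pos by (simp add: power_mult_distrib pos_le_divide_eq mult.commute)
  qed
  have rY: "random_var M Y"
  proof (rule random_var_resolvent[OF A, of \<gamma>])
    show "random_var M (\<lambda>x. W x - \<gamma> *\<^sub>R X x)"
      using rW X(1) by (intro sq)
  qed (use Y \<open>0 < \<gamma>\<close> in auto)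
  have iVN': "integrable M (\<lambda>x. (norm (V x - \<gamma> *\<^sub>R N x))\<^sup>2)"
    using V N by (intro sq)
  then have iVN: "integrable M (\<lambda>x. (norm (V x - \<gamma> *\<^sub>R N x))\<^sup>2 / (1 + \<gamma> * \<nu>)\<^sup>2)"
    by simp
  have "integrable M (\<lambda>x. (norm (Y x - v))\<^sup>2)"
    using backward by (intro integrable_norm_sq_bound[OF _ iVN] sq rY)
  from integrable_norm_sq_add[OF random_var_diff[OF rY const(1)] const(1) this const(2), of v]
  have iY: "integrable M (\<lambda>x. (norm (Y x))\<^sup>2)"
    by simp
  have "random_var M (\<lambda>x. (1 - l) *\<^sub>R W x + l *\<^sub>R Y x)"
    using rW rY by (intro sq)
  then show rW': "random_var M W'"
    by (rule random_var_cong) (simp add: W')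
  have "integrable M (\<lambda>x. (norm ((1 - l) *\<^sub>R W x + l *\<^sub>R Y x))\<^sup>2)"
    using rW W rY iY by (intro sq)
  then show iW': "integrable M (\<lambda>x. (norm (W' x))\<^sup>2)"
    by (rule Bochner_Integration.integrable_cong[THEN iffD1, rotated 2]) (auto simp: W')
  have iW'v: "integrable M (\<lambda>x. (norm (W' x - v))\<^sup>2)"
    using rW' iW' by (intro sq)
  have convex: "(norm (W' x - v))\<^sup>2
      \<le> (1 - l) * (norm (W x - v))\<^sup>2 + l * ((norm (V x - \<gamma> *\<^sub>R N x))\<^sup>2 / (1 + \<gamma> * \<nu>)\<^sup>2)"
    if "x \<in> space M" for x
  proof -
    have "W' x - v = (1 - l) *\<^sub>R (W x - v) + l *\<^sub>R (Y x - v)"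
      using W'[OF that] by (simp add: algebra_simps)
    then have "(norm (W' x - v))\<^sup>2 \<le> (1 - l) * (norm (W x - v))\<^sup>2 + l * (norm (Y x - v))\<^sup>2"
      using norm_sq_convex[OF l] by simp
    also have "\<dots> \<le> (1 - l) * (norm (W x - v))\<^sup>2 + l * ((norm (V x - \<gamma> *\<^sub>R N x))\<^sup>2 / (1 + \<gamma> * \<nu>)\<^sup>2)"
      using backward[OF that] l by (intro add_left_mono mult_left_mono) auto
    finally show ?thesis .
  qed
  have "(\<integral>x. (norm (W' x - v))\<^sup>2 \<partial>M)
      \<le> (\<integral>x. (1 - l) * (norm (W x - v))\<^sup>2 + l * ((norm (V x - \<gamma> *\<^sub>R N x))\<^sup>2 / (1 + \<gamma> * \<nu>)\<^sup>2) \<partial>M)"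
    using convex by (intro integral_mono[OF iW'v Bochner_Integration.integrable_add] integrable_mult_right iW iVN)
  also have "\<dots> = (1 - l) * S + l / (1 + \<gamma> * \<nu>)\<^sup>2 * (\<integral>x. (norm (V x - \<gamma> *\<^sub>R N x))\<^sup>2 \<partial>M)"
    using iW iVN' by (simp add: S_def)
  also have "\<dots> \<le> (1 - l) * S + l / (1 + \<gamma> * \<nu>)\<^sup>2
      * ((1 - \<epsilon> * \<mu> * \<gamma>) * S + 2 * \<gamma>\<^sup>2 * \<sigma>\<^sup>2 * (1 + \<alpha> * (norm (B v))\<^sup>2))"
    using forward l by (intro add_left_mono mult_left_mono) auto
  finally show "(\<integral>x. (norm (W' x - v))\<^sup>2 \<partial>M) \<le> (1 - l) * (\<integral>x. (norm (W x - v))\<^sup>2 \<partial>M)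
      + l / (1 + \<gamma> * \<nu>)\<^sup>2 * ((1 - \<epsilon> * \<mu> * \<gamma>) * (\<integral>x. (norm (W x - v))\<^sup>2 \<partial>M)
        + 2 * \<gamma>\<^sup>2 * \<sigma>\<^sup>2 * (1 + \<alpha> * (norm (B v))\<^sup>2))"
    unfolding S_def .
qed

text \<open>
  The factor in front of \<open>S\<close> is \<open>1 - l * ((2 * \<nu> + \<mu> * \<epsilon>) * \<gamma> + (\<gamma> * \<nu>)\<^sup>2) / (1 + \<gamma> * \<nu>)\<^sup>2\<close>. Dropping
  the square and using \<open>\<gamma> \<le> 1\<close> in the denominator makes its defect linear in \<open>\<gamma>\<close>.
\<close>

lemma contraction_factor_bound:
  fixes \<nu> \<mu> \<epsilon> \<gamma> l lam :: real
  assumes "0 \<le> \<nu>" "0 \<le> \<mu>" "0 \<le> \<epsilon>" "0 < \<gamma>" "\<gamma> \<le> 1" "0 \<le> lam" "lam \<le> l" "l \<le> 1" "0 \<le> S" "0 \<le> T"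
  shows "(1 - l) * S + l / (1 + \<gamma> * \<nu>)\<^sup>2 * ((1 - \<epsilon> * \<mu> * \<gamma>) * S + T)
    \<le> (1 - lam * (2 * \<nu> + \<mu> * \<epsilon>) / (1 + \<nu>)\<^sup>2 * \<gamma>) * S + T"
proof -
  define \<kappa> where "\<kappa> = (1 + \<gamma> * \<nu>)\<^sup>2"
  have "\<gamma> * \<nu> \<le> 1 * \<nu>"
    using assms by (intro mult_right_mono) auto
  then have \<kappa>: "1 \<le> \<kappa>" "\<kappa> \<le> (1 + \<nu>)\<^sup>2"
    using assms by (auto simp: \<kappa>_def intro!: power_mono one_le_power)
  have "lam * (2 * \<nu> + \<mu> * \<epsilon>) / (1 + \<nu>)\<^sup>2 * \<gamma> = lam * ((2 * \<nu> + \<mu> * \<epsilon>) * \<gamma>) / (1 + \<nu>)\<^sup>2"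
    by simp
  also have "\<dots> \<le> l * ((2 * \<nu> + \<mu> * \<epsilon>) * \<gamma> + (\<gamma> * \<nu>)\<^sup>2) / \<kappa>"
    using assms \<kappa> by (intro frac_le mult_mono) auto
  also have "\<dots> = l - l / \<kappa> * (1 - \<epsilon> * \<mu> * \<gamma>)"
    using \<kappa> by (simp add: \<kappa>_def field_simps power2_eq_square)
  finally have "(1 - l + l / \<kappa> * (1 - \<epsilon> * \<mu> * \<gamma>)) * S
      \<le> (1 - lam * (2 * \<nu> + \<mu> * \<epsilon>) / (1 + \<nu>)\<^sup>2 * \<gamma>) * S"
    using assms by (intro mult_right_mono) auto
  moreover have "l / \<kappa> * T \<le> 1 * T"
    using assms \<kappa> by (intro mult_right_mono) (auto simp: divide_le_eq)
  moreover have "(1 - l) * S + l / \<kappa> * ((1 - \<epsilon> * \<mu> * \<gamma>) * S + T)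
      = (1 - l + l / \<kappa> * (1 - \<epsilon> * \<mu> * \<gamma>)) * S + l / \<kappa> * T"
    by (simp add: algebra_simps add_divide_distrib diff_divide_distrib)
  ultimately show ?thesis
    unfolding \<kappa>_def[symmetric] by linarith
qed

section \<open>Convergence in mean square\<close>

theorem theorem3p9:
  fixes M :: "'a measure"
    and A :: "'h::{real_inner, complete_space} \<Rightarrow> 'h set"
    and B :: "'h \<Rightarrow> 'h"
    and wbar :: 'h
    and \<beta> \<nu> \<mu> lam_low \<alpha>_up \<theta> c1 \<sigma> \<epsilon> t c \<tau> :: real
    and \<gamma> lam \<alpha> s :: "nat \<Rightarrow> real"
    and Bs w y z :: "nat \<Rightarrow> 'a \<Rightarrow> 'h"
    and n0 :: nat
  assumes "prob_space M"
    and "maximally_monotone_op A"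
    and "\<beta> > 0" and "cocoercive \<beta> B"
    and "wbar \<in> zer_sum A B"
    and "\<nu> \<ge> 0" and "\<mu> \<ge> 0" and "\<nu> + \<mu> > 0"
    and "strongly_monotone_op \<nu> A"
    and "strongly_monotone_at \<mu> B wbar"
    and "lam_low > 0" and "\<alpha>_up > 0"
    and "0 < \<theta>" and "\<theta> \<le> 1"
    and "c1 > 0"
    and "\<forall>n\<ge>1. \<gamma> n = c1 * real n powr (-\<theta>)"
    and "\<forall>n\<ge>1. 0 \<le> lam n \<and> lam n \<le> 1"
    and "(INF n\<in>{1..}. lam n) \<ge> lam_low"
    and "\<forall>n\<ge>1. random_var M (Bs n) \<and> integrable M (\<lambda>x. (norm (Bs n x))\<^sup>2)"
    and "random_var M (w 1)" and "integrable M (\<lambda>x. (norm (w 1 x))\<^sup>2)"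
    and "\<forall>n\<ge>1. \<forall>x\<in>space M. z n x = w n x - \<gamma> n *\<^sub>R Bs n x"
    and "\<forall>n\<ge>1. \<forall>x\<in>space M. y n x \<in> resolvent (\<gamma> n) A (z n x)"
    and "\<forall>n\<ge>1. \<forall>x\<in>space M. w (Suc n) x = (1 - lam n) *\<^sub>R w n x + lam n *\<^sub>R y n x"
    and "\<forall>n\<ge>1. 0 < \<alpha> n \<and> \<alpha> n \<le> \<alpha>_up"
    and "\<sigma> > 0" and "\<epsilon> > 0"
    and "\<forall>n\<ge>1. has_cond_exp M (gen_sigma M w n) (Bs n) (\<lambda>x. B (w n x))"
    and "\<forall>n\<ge>1. AE x in M.
           real_cond_exp M (gen_sigma M w n) (\<lambda>x. (norm (Bs n x - B (w n x)))\<^sup>2) x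
             \<le> \<sigma>\<^sup>2 * (1 + \<alpha> n * (norm (B (w n x)))\<^sup>2)"
    and "\<forall>n\<ge>1. \<gamma> n \<le> (2 - \<epsilon>) * \<beta> / (1 + 2 * \<sigma>\<^sup>2 * \<alpha> n)"
    and "t = 1 - 2 powr (\<theta> - 1)"
    and "c = c1 * lam_low * (2 * \<nu> + \<mu> * \<epsilon>) / (1 + \<nu>)\<^sup>2"
    and "\<tau> = 2 * \<sigma>\<^sup>2 * c1\<^sup>2 * (1 + \<alpha>_up * (norm (B wbar))\<^sup>2) / c\<^sup>2"
    and "n0 = (LEAST k::nat. k > 1 \<and> (\<forall>n\<ge>k. max c c1 * real n powr (-\<theta>) \<le> 1))"
    and "\<forall>n\<ge>1. s n = prob_space.expectation M (\<lambda>x. (norm (w n x - wbar))\<^sup>2)"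
  shows "(\<theta> < 1 \<longrightarrow> (\<forall>n\<ge>2 * n0.
            s (n + 1) \<le>
              (\<tau> * c\<^sup>2 * phi (1 - 2 * \<theta>) (real n)
                 + s n0 * exp (c * real n0 powr (1 - \<theta>) / (1 - \<theta>)))
                * exp (- c * t * real (n + 1) powr (1 - \<theta>) / (1 - \<theta>))
              + \<tau> * 2 powr \<theta> * c / (real n - 2) powr \<theta>))
       \<and> (\<theta> = 1 \<longrightarrow> (\<forall>n\<ge>2 * n0.
            s (n + 1) \<le>
              s n0 * (real n0 / real (n + 1)) powr c
              + \<tau> * c\<^sup>2 / real (n + 1) powr c * (1 + 1 / real n0) powr c * phi (c - 1) (real n)))
       \<and> (\<theta> < 1 \<longrightarrow> s \<in> O(\<lambda>n. real n powr (-\<theta>)))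
       \<and> (\<theta> = 1 \<and> c < 1 \<longrightarrow> s \<in> O(\<lambda>n. real n powr (-c)))
       \<and> (\<theta> = 1 \<and> c = 1 \<longrightarrow> s \<in> O(\<lambda>n. ln (real n) / real n))
       \<and> (\<theta> = 1 \<and> c > 1 \<longrightarrow> s \<in> O(\<lambda>n. 1 / real n))"
proof -
  have \<beta>: "0 < \<beta>" and \<nu>: "0 \<le> \<nu>" and \<mu>: "0 \<le> \<mu>" and \<nu>\<mu>: "0 < \<nu> + \<mu>"
    and lam_low: "0 < lam_low" and \<alpha>_up: "0 < \<alpha>_up" and \<theta>: "0 < \<theta>" "\<theta> \<le> 1"
    and c1: "0 < c1" and \<sigma>: "0 < \<sigma>" and \<epsilon>: "0 < \<epsilon>"
    by (fact assms)+
  have \<gamma>: "\<gamma> n = c1 * real n powr (-\<theta>)" "0 < \<gamma> n" if "1 \<le> n" for n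
    using assms(16) that c1 by auto
  have lam: "0 \<le> lam n" "lam n \<le> 1" "lam_low \<le> lam n" if "1 \<le> n" for n
  proof -
    have "bdd_below (lam ` {1..})"
      using assms(17) by (intro bdd_belowI[of _ 0]) auto
    then have "(INF n\<in>{1..}. lam n) \<le> lam n"
      using that by (intro cINF_lower) auto
    then show "lam_low \<le> lam n"
      using assms(18) by linarith
  qed (use assms(17) that in auto)
  have \<alpha>: "0 < \<alpha> n" "\<alpha> n \<le> \<alpha>_up" if "1 \<le> n" for n
    using assms(25) that by auto
  have update: "random_var M (w (Suc n))" "integrable M (\<lambda>x. (norm (w (Suc n) x))\<^sup>2)"
    "(\<integral>x. (norm (w (Suc n) x - wbar))\<^sup>2 \<partial>M) \<le> (1 - lam n) * (\<integral>x. (norm (w n x - wbar))\<^sup>2 \<partial>M)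
      + lam n / (1 + \<gamma> n * \<nu>)\<^sup>2 * ((1 - \<epsilon> * \<mu> * \<gamma> n) * (\<integral>x. (norm (w n x - wbar))\<^sup>2 \<partial>M)
        + 2 * (\<gamma> n)\<^sup>2 * \<sigma>\<^sup>2 * (1 + \<alpha> n * (norm (B wbar))\<^sup>2))"
    if "1 \<le> n" and w: "\<And>i. 1 \<le> i \<Longrightarrow> i \<le> n \<Longrightarrow> random_var M (w i)"
      and sq: "integrable M (\<lambda>x. (norm (w n x))\<^sup>2)" for n
  proof -
    have sub: "subalgebra M (gen_sigma M w n)"
      using w by (intro gen_sigma_subalgebra random_var_measurable)
    have W: "random_var (gen_sigma M w n) (w n)"
      using w that(1) by (intro random_var_gen_sigma) auto
    have Y: "y n x \<in> resolvent (\<gamma> n) A (w n x - \<gamma> n *\<^sub>R Bs n x)" if "x \<in> space M" for x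
      using assms(22,23) \<open>1 \<le> n\<close> that by force
    have W': "w (Suc n) x = (1 - lam n) *\<^sub>R w n x + lam n *\<^sub>R y n x" if "x \<in> space M" for x
      using assms(24) \<open>1 \<le> n\<close> that by blast
    note facts = assms(1) sub assms(9) \<nu> assms(4) \<beta> assms(10,5) W sq
      assms(19)[rule_format, OF \<open>1 \<le> n\<close>, THEN conjunct1]
      assms(19)[rule_format, OF \<open>1 \<le> n\<close>, THEN conjunct2]
      assms(28,29)[rule_format, OF \<open>1 \<le> n\<close>]
      less_imp_le[OF \<epsilon>] \<gamma>(2)[OF \<open>1 \<le> n\<close>] less_imp_le[OF \<alpha>(1)[OF \<open>1 \<le> n\<close>]]
      assms(30)[rule_format, OF \<open>1 \<le> n\<close>] lam(1,2)[OF \<open>1 \<le> n\<close>] Y W'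
    show "random_var M (w (Suc n))" "integrable M (\<lambda>x. (norm (w (Suc n) x))\<^sup>2)"
      "(\<integral>x. (norm (w (Suc n) x - wbar))\<^sup>2 \<partial>M) \<le> (1 - lam n) * (\<integral>x. (norm (w n x - wbar))\<^sup>2 \<partial>M)
        + lam n / (1 + \<gamma> n * \<nu>)\<^sup>2 * ((1 - \<epsilon> * \<mu> * \<gamma> n) * (\<integral>x. (norm (w n x - wbar))\<^sup>2 \<partial>M)
          + 2 * (\<gamma> n)\<^sup>2 * \<sigma>\<^sup>2 * (1 + \<alpha> n * (norm (B wbar))\<^sup>2))"
      by (rule stochastic_forward_backward_step[OF facts]; assumption)+
  qed
  \<comment> \<open>Conditioning at time \<open>n\<close> involves the whole past, so all earlier iterates enter the induction.\<close>
  have regular: "\<forall>i. 1 \<le> i \<and> i \<le> n \<longrightarrow> random_var M (w i) \<and> integrable M (\<lambda>x. (norm (w i x))\<^sup>2)"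
    if "1 \<le> n" for n
    using that
  proof (induction n rule: dec_induct)
    case base
    then show ?case using assms(20,21) by (auto simp: le_antisym)
  next
    case (step n)
    then show ?case
      using update(1,2)[of n] by (auto simp: le_Suc_eq)
  qed
  have s_nonneg: "0 \<le> s n" if "1 \<le> n" for n
    using assms(35) that by simp

  \<comment> \<open>The constants of the statement, and the index \<open>n0\<close> from which all step sizes are at most one.\<close>
  have "0 < 2 * \<nu> + \<mu> * \<epsilon>"
  proof (cases "\<nu> = 0")
    case True
    then show ?thesis using \<nu>\<mu> \<epsilon> by simp
  next
    case False
    then have "0 < \<nu>" using \<nu> by simp
    then show ?thesis using \<mu> \<epsilon> by (simp add: add_pos_nonneg)
  qed
  then have c: "0 < c"
    using c1 lam_low \<nu> unfolding assms(32) by (intro divide_pos_pos mult_pos_pos) auto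
  have \<tau>c: "\<tau> * c\<^sup>2 = 2 * \<sigma>\<^sup>2 * c1\<^sup>2 * (1 + \<alpha>_up * (norm (B wbar))\<^sup>2)"
    using c by (simp add: assms(33))
  have \<tau>: "0 \<le> \<tau>"
    using \<alpha>_up unfolding assms(33) by (intro divide_nonneg_nonneg mult_nonneg_nonneg) auto
  have "\<exists>k>1. \<forall>n\<ge>k. max c c1 * real n powr (-\<theta>) \<le> 1"
  proof -
    have "(\<lambda>n. max c c1 * real n powr (-\<theta>)) \<longlonglongrightarrow> max c c1 * 0"
      using \<theta> by (intro tendsto_mult_left) real_asymp
    then have "eventually (\<lambda>n. max c c1 * real n powr (-\<theta>) < 1) sequentially"
      by (rule order_tendstoD) simp
    then obtain N where "\<forall>n\<ge>N. max c c1 * real n powr (-\<theta>) < 1"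
      by (auto simp: eventually_sequentially)
    then show ?thesis
      by (intro exI[of _ "max N 2"]) (auto simp: less_imp_le)
  qed
  from LeastI_ex[OF this]
  have least: "1 < n0 \<and> (\<forall>n\<ge>n0. max c c1 * real n powr (-\<theta>) \<le> 1)"
    unfolding assms(34) .
  then have n0: "max c c1 * real n powr (-\<theta>) \<le> 1" if "n0 \<le> n" for n
    using that by blast
  from least have "1 < n0" ..
  then have "2 \<le> n0" by simp
  have small: "c * real n powr (-\<theta>) \<le> 1" "c1 * real n powr (-\<theta>) \<le> 1" if "n0 \<le> n" for n
    using n0[OF that] mult_right_mono[of c "max c c1" "real n powr (-\<theta>)"]
      mult_right_mono[of c1 "max c c1" "real n powr (-\<theta>)"] by auto
  have rec: "s (Suc n) \<le> (1 - c * real n powr (-\<theta>)) * s n + \<tau> * (c * real n powr (-\<theta>))\<^sup>2"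
    if "n0 \<le> n" for n
  proof -
    have n: "1 \<le> n" using that \<open>2 \<le> n0\<close> by simp
    let ?T = "2 * (\<gamma> n)\<^sup>2 * \<sigma>\<^sup>2 * (1 + \<alpha> n * (norm (B wbar))\<^sup>2)"
    have "s (Suc n) \<le> (1 - lam n) * s n
        + lam n / (1 + \<gamma> n * \<nu>)\<^sup>2 * ((1 - \<epsilon> * \<mu> * \<gamma> n) * s n + ?T)"
      using update(3)[OF n] regular[OF n] n assms(35) by simp
    also have "\<dots> \<le> (1 - lam_low * (2 * \<nu> + \<mu> * \<epsilon>) / (1 + \<nu>)\<^sup>2 * \<gamma> n) * s n + ?T"
    proof (rule contraction_factor_bound)
      show "0 \<le> ?T"
        using \<alpha>(1)[OF n] by (intro mult_nonneg_nonneg) auto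
      show "\<gamma> n \<le> 1"
        using \<gamma>(1)[OF n] small(2)[OF that] by simp
    qed (use \<nu> \<mu> \<epsilon> \<gamma>(2)[OF n] lam_low lam[OF n] s_nonneg[OF n] in auto)
    also have "lam_low * (2 * \<nu> + \<mu> * \<epsilon>) / (1 + \<nu>)\<^sup>2 * \<gamma> n = c * real n powr (-\<theta>)"
      unfolding \<gamma>(1)[OF n] assms(32) by simp
    also have "?T \<le> \<tau> * (c * real n powr (-\<theta>))\<^sup>2"
    proof -
      have "?T \<le> 2 * (\<gamma> n)\<^sup>2 * \<sigma>\<^sup>2 * (1 + \<alpha>_up * (norm (B wbar))\<^sup>2)"
        using \<alpha>[OF n] by (intro mult_left_mono add_left_mono mult_right_mono) auto
      also have "\<dots> = (\<tau> * c\<^sup>2) * (real n powr (-\<theta>))\<^sup>2"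
        unfolding \<tau>c \<gamma>(1)[OF n] by (simp add: power_mult_distrib)
      finally show ?thesis
        by (simp add: power_mult_distrib)
    qed
    finally show ?thesis by simp
  qed

  have i: "s (n + 1) \<le>
      (\<tau> * c\<^sup>2 * phi (1 - 2 * \<theta>) (real n) + s n0 * exp (c * real n0 powr (1 - \<theta>) / (1 - \<theta>)))
        * exp (- c * t * real (n + 1) powr (1 - \<theta>) / (1 - \<theta>))
      + \<tau> * 2 powr \<theta> * c / (real n - 2) powr \<theta>" if "\<theta> < 1" "2 * n0 \<le> n" for n
    unfolding assms(31) using rec small(1) c \<tau> \<open>2 \<le> n0\<close> \<theta> that s_nonneg
    by (intro recursion_bound_theta_less_one) auto
  have ii: "s (n + 1) \<le> s n0 * (real n0 / real (n + 1)) powr c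
      + \<tau> * c\<^sup>2 / real (n + 1) powr c * (1 + 1 / real n0) powr c * phi (c - 1) (real n)"
    if "\<theta> = 1" "2 * n0 \<le> n" for n
  proof (rule recursion_bound_theta_one)
    show "s (Suc k) \<le> (1 - c / real k) * s k + \<tau> * (c / real k)\<^sup>2" if "n0 \<le> k" for k
      using rec[OF that] \<open>2 \<le> n0\<close> that \<open>\<theta> = 1\<close> by (simp add: powr_minus_divide)
    show "c \<le> real n0"
      using small(1)[of n0] \<open>2 \<le> n0\<close> \<open>\<theta> = 1\<close> by (simp add: powr_minus_divide divide_le_eq)
  qed (use c \<tau> \<open>2 \<le> n0\<close> that s_nonneg in auto)
  have iii: "s \<in> O(\<lambda>n. real n powr (-\<theta>))" if "\<theta> < 1"
  proof (rule rate_theta_less_one)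
    show "s (n + 1) \<le> (\<tau> * c\<^sup>2 * phi (1 - 2 * \<theta>) (real n) + s n0 * exp (c * real n0 powr (1 - \<theta>) / (1 - \<theta>)))
        * exp (- (c * t) * real (n + 1) powr (1 - \<theta>) / (1 - \<theta>))
        + (\<tau> * 2 powr \<theta> * c) / (real n - 2) powr \<theta>" if "2 * n0 \<le> n" for n
      using i[OF \<open>\<theta> < 1\<close> that] by simp
    have "2 powr (\<theta> - 1) < 2 powr (0::real)"
      using that by (intro powr_less_mono) auto
    then show "0 < c * t"
      using c by (simp add: assms(31))
  qed (use \<tau> \<theta> that s_nonneg in auto)
  have iv: "c < 1 \<Longrightarrow> s \<in> O(\<lambda>n. real n powr (-c))" "c = 1 \<Longrightarrow> s \<in> O(\<lambda>n. ln (real n) / real n)"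
    "1 < c \<Longrightarrow> s \<in> O(\<lambda>n. 1 / real n)" if "\<theta> = 1"
  proof -
    have bound: "s (n + 1) \<le> s n0 * (real n0 / real (n + 1)) powr c
        + (\<tau> * c\<^sup>2 * (1 + 1 / real n0) powr c) / real (n + 1) powr c * phi (c - 1) (real n)"
      if "2 * n0 \<le> n" for n
      using ii[OF \<open>\<theta> = 1\<close> that] by simp
    have "0 \<le> s (n + 1)" for n
      using s_nonneg by simp
    note rates = rate_theta_one[OF this bound _ _ c]
    show "c < 1 \<Longrightarrow> s \<in> O(\<lambda>n. real n powr (-c))" "c = 1 \<Longrightarrow> s \<in> O(\<lambda>n. ln (real n) / real n)"
      "1 < c \<Longrightarrow> s \<in> O(\<lambda>n. 1 / real n)"
      by (rule rates; use \<tau> in simp)+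
  qed
  show ?thesis
    using i ii iii iv by blast
qed

end
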